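(* $\mathfrak{hp}\geq\mathrm{cov}(\mathcal{M})$ and $\mathfrak{hp}\geq\mathrm{cov}(\mathcal{N})$.
   Context: A compactification $\alpha\omega$ of the countable discrete space $\omega$ is a compact Hausdorff space containing $\omega$ as a dense subspace. $\alpha\omega\leq\gamma\omega$ means there is a continuous surjection $f:\gamma\omega\to\alpha\omega$ whose restriction to $\omega$ is the identity; $\alpha\omega\simeq\gamma\omega$ means such an $f$ can be chosen to be a homeomorphism. Modulo $\simeq$, compactifications of $\omega$ ordered by $\leq$ form a complete upper semilattice with largest element the Stone–Čech compactification $\beta\omega$; $\sup$ is taken in it. $C_{\alpha\omega}$ denotes the set of bounded functions $\omega\to\mathbb{R}$ that extend continuously over $\alpha\omega$; it determines $\alpha\omega$ up to $\simeq$, and every subring of the ring of bounded functions on $\omega$ that is closed in the uniform norm, contains all constants and generates the topology of $\omega$ is of this form. A metric $d$ on $\omega$ is proper if each $d$-bounded set has compact closure. $\mathrm{PM}(\omega)$ is the set of all proper metrics on $\omega$ compatible with the discrete topology. For $d\in\mathrm{PM}(\omega)$, a function $f:\omega\to\mathbb{R}$ is slowly oscillating with respect to $d$ if for all $r>0$ and $\varepsilon>0$ there is a compact (i.e. finite) $K\subseteq\omega$ such that $\mathrm{diam}\, f[\mathrm{B}_d(x,r)]<\varepsilon$ for all $x\in\omega\setminus K$. $C^*_d(\omega)$ is the ring of all bounded slowly oscillating functions from $(\omega,d)$ to $\mathbb{R}$, and the Higson compactification $\overline{\omega}^d$ is the compactification with $C_{\overline{\omega}^d}=C^*_d(\omega)$.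 $\mathrm{PM}'(\omega)$ is the set of $d\in\mathrm{PM}(\omega)$ with $\beta\omega\not\simeq\overline{\omega}^d$. A set $D\subseteq\mathrm{PM}'(\omega)$ has the Higson finite intersection property (Higson-FIP) if for every finite $F\subseteq D$, $\beta\omega\not\simeq\sup\{\overline{\omega}^d: d\in F\}$. $\mathfrak{hp}$ is the smallest cardinality of a set $D\subseteq\mathrm{PM}'(\omega)$ with the Higson-FIP such that $\beta\omega\simeq\sup\{\overline{\omega}^d: d\in D\}$. $\mathcal{M}$ and $\mathcal{N}$ are the ideals of meager and of measure zero subsets of the Cantor space $2^\omega$ (with the usual product measure). For a collection $\mathcal{X}$ of subsets of $2^\omega$, $\mathrm{cov}(\mathcal{X})$ is the smallest cardinality of $\mathcal{X}'\subseteq\mathcal{X}$ with $\bigcup\mathcal{X}'=2^\omega$. Convention: if no set of the required kind exists, the cardinal being defined is $\infty$, and $\lambda<\infty$ for every cardinal $\lambda$. *)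

theory Defs
  imports "HOL-Probability.Probability"
begin

unbundle cardinal_syntax

text \<open>A cardinal is represented by a cardinal order of the shape \<^term>\<open>|A|\<close>. The predicate
  \<^term>\<open>P\<close> in \<open>least_card P\<close> says which sets are of the required kind. The two sides of
  \<open>ecard_le\<close> may live on different types.
  A minimal cardinality exists by well-foundedness of the order on cardinals.\<close>

datatype 'a ecard = Card "'a rel" | Infty

definition least_card :: "('a set \<Rightarrow> bool) \<Rightarrow> 'a ecard" where
  "least_card P =
     (if \<exists>A. P A
      then Card (SOME r. \<exists>A. P A \<and> r = |A| \<and> (\<forall>B. P B \<longrightarrow> |A| \<le>o |B| ))
      else Infty)"

fun ecard_le :: "'a ecard \<Rightarrow> 'b ecard \<Rightarrow> bool" where
  "ecard_le _ Infty \<longleftrightarrow> True"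
| "ecard_le Infty (Card s) \<longleftrightarrow> False"
| "ecard_le (Card r) (Card s) \<longleftrightarrow> r \<le>o s"

text \<open>The copy of \<open>\<omega>\<close> inside the compact space is the range of the embedding \<^term>\<open>e\<close>, so
  ``identity on \<open>\<omega>\<close>'' means commuting with the embeddings.\<close>

type_synonym 'a cptf = "'a topology \<times> (nat \<Rightarrow> 'a)"

definition compactification :: "'a cptf \<Rightarrow> bool" where
  "compactification = (\<lambda>(X, e).
     compact_space X \<and> Hausdorff_space X \<and>
     embedding_map (discrete_topology UNIV) X e \<and>
     X closure_of (range e) = topspace X)"

definition cptf_le :: "'a cptf \<Rightarrow> 'b cptf \<Rightarrow> bool" where
  "cptf_le = (\<lambda>(X, e) (Y, g).
     \<exists>f. continuous_map Y X f \<and> f ` topspace Y = topspace X \<and> (\<forall>n. f (g n) = e n))"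

definition cptf_eq :: "'a cptf \<Rightarrow> 'b cptf \<Rightarrow> bool" where
  "cptf_eq = (\<lambda>(X, e) (Y, g). \<exists>f. homeomorphic_map Y X f \<and> (\<forall>n. f (g n) = e n))"

definition ext_ring :: "'a cptf \<Rightarrow> (nat \<Rightarrow> real) set" where
  "ext_ring = (\<lambda>(X, e).
     {f. bounded (range f) \<and> (\<exists>g. continuous_map X euclideanreal g \<and> (\<forall>n. g (e n) = f n))})"

text \<open>A compactification \<open>K\<close> of \<open>\<omega>\<close> embeds into a power of the real line indexed by
  \<^term>\<open>ext_ring K\<close>. Hence, up to equivalence, every compactification lives on the following
  type, and the order-theoretic notions below do not depend on this choice of a universe.
  The objects picked by \<open>SOME\<close> exist and are determined up to \<^const>\<open>cptf_eq\<close>.\<close>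

type_synonym point = "(nat \<Rightarrow> real) \<Rightarrow> real"

definition beta_omega :: "point cptf" where
  "beta_omega =
     (SOME K. compactification K \<and> (\<forall>L :: point cptf. compactification L \<longrightarrow> cptf_le L K))"

definition cptf_sup :: "point cptf set \<Rightarrow> point cptf" where
  "cptf_sup S =
     (SOME K. compactification K \<and> (\<forall>L\<in>S. cptf_le L K) \<and>
        (\<forall>M :: point cptf. compactification M \<and> (\<forall>L\<in>S. cptf_le L M) \<longrightarrow> cptf_le K M))"

definition PM :: "(nat \<Rightarrow> nat \<Rightarrow> real) set" where
  "PM = {d. Metric_space UNIV d \<and>
            Metric_space.mtopology UNIV d = discrete_topology UNIV \<and>
            (\<forall>B. Metric_space.mbounded UNIV d B \<longrightarrow>
                 compactin (Metric_space.mtopology UNIV d)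
                   (Metric_space.mtopology UNIV d closure_of B))}"

text \<open>Compact subsets of the discrete space \<open>\<omega>\<close> are the finite ones; balls are open, which is
  immaterial as all radii are quantified over.\<close>

definition slowly_oscillating :: "(nat \<Rightarrow> nat \<Rightarrow> real) \<Rightarrow> (nat \<Rightarrow> real) \<Rightarrow> bool" where
  "slowly_oscillating d f \<longleftrightarrow>
     (\<forall>r>0. \<forall>\<epsilon>>0. \<exists>K. finite K \<and>
        (\<forall>x\<in>-K. diameter (f ` Metric_space.mball UNIV d x r) < \<epsilon>))"

definition higson_ring :: "(nat \<Rightarrow> nat \<Rightarrow> real) \<Rightarrow> (nat \<Rightarrow> real) set" where
  "higson_ring d = {f. bounded (range f) \<and> slowly_oscillating d f}"

definition higson :: "(nat \<Rightarrow> nat \<Rightarrow> real) \<Rightarrow> point cptf" where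
  "higson d = (SOME K. compactification K \<and> ext_ring K = higson_ring d)"

definition PM' :: "(nat \<Rightarrow> nat \<Rightarrow> real) set" where
  "PM' = {d \<in> PM. \<not> cptf_eq beta_omega (higson d)}"

definition higson_FIP :: "(nat \<Rightarrow> nat \<Rightarrow> real) set \<Rightarrow> bool" where
  "higson_FIP D \<longleftrightarrow>
     (\<forall>F. finite F \<and> F \<subseteq> D \<longrightarrow> \<not> cptf_eq beta_omega (cptf_sup (higson ` F)))"

definition hp :: "(nat \<Rightarrow> nat \<Rightarrow> real) ecard" where
  "hp = least_card (\<lambda>D. D \<subseteq> PM' \<and> higson_FIP D \<and>
                        cptf_eq beta_omega (cptf_sup (higson ` D)))"

definition cantor_topology :: "(nat \<Rightarrow> bool) topology" where
  "cantor_topology = product_topology (\<lambda>_. discrete_topology UNIV) UNIV"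

definition cantor_measure :: "(nat \<Rightarrow> bool) measure" where
  "cantor_measure = Pi\<^sub>M UNIV (\<lambda>_. uniform_count_measure UNIV)"

definition nowhere_dense_in :: "'a topology \<Rightarrow> 'a set \<Rightarrow> bool" where
  "nowhere_dense_in X A \<longleftrightarrow> A \<subseteq> topspace X \<and> X interior_of (X closure_of A) = {}"

definition meager_ideal :: "(nat \<Rightarrow> bool) set set" where
  "meager_ideal =
     {A. \<exists>\<S>. countable \<S> \<and> (\<forall>S\<in>\<S>. nowhere_dense_in cantor_topology S) \<and> A = \<Union>\<S>}"

definition null_ideal :: "(nat \<Rightarrow> bool) set set" where
  "null_ideal = null_sets (completion cantor_measure)"

definition cov :: "(nat \<Rightarrow> bool) set set \<Rightarrow> (nat \<Rightarrow> bool) set ecard" where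
  "cov \<X> = least_card (\<lambda>\<Y>. \<Y> \<subseteq> \<X> \<and> \<Union>\<Y> = UNIV)"

end

theory Submission
  imports Defs
begin

text \<open>Let \<open>D\<close> have the Higson-FIP with supremum \<open>\<beta>\<omega>\<close>. By compactness every
  \<open>A \<subseteq> \<omega>\<close> is separated from its complement by the supremum over a finite
  \<open>F \<subseteq> D\<close>, and by the FIP no single finite \<open>F\<close> separates all sets. As \<open>D\<close> is
  infinite, it suffices to cover the family of sets separated by a given \<open>F\<close> by countably many closed
  null subsets of \<open>2\<^sup>\<omega>\<close>, for these are also nowhere dense.

  If \<open>A\<close> is separated by \<open>F\<close>, then there are a finite set of colours and an assignment of metrics
  in \<open>F\<close> to pairs of colours such that at every scale \<open>r\<close> the integers beyond some \<open>m\<close> can be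
  coloured so that \<open>x \<in> A\<close> and \<open>y \<notin> A\<close> have distance more than \<open>r\<close> in the metric assigned
  to their colours. For fixed data these conditions define a closed set. If at each scale one of these
  closed sets had positive measure, then by a Steinhaus argument every set would agree beyond some
  integer with a symmetric difference of two of its members, so with product colours every set would be
  colourable at every scale. Colourings at different scales can be merged along a sufficiently sparse
  sequence of blocks, hence every set would be separated by \<open>F\<close>, contrary to the FIP. So some scale
  yields only closed null sets.\<close>

section \<open>Compactifications generated by rings of functions\<close>

text \<open>Compactifications are realised as closures of \<open>\<omega>\<close> in a power of the line: a family
  \<open>R\<close> of functions gives the closure of the points \<open>(f n)\<close>, with junk value \<open>0\<close> in
  the coordinates \<open>f \<notin> R\<close>. The family is admissible when this is a compactification.\<close>

definition ev :: "(nat \<Rightarrow> real) set \<Rightarrow> nat \<Rightarrow> point" where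
  "ev R n = (\<lambda>f. if f \<in> R then f n else 0)"

definition ring_space :: "(nat \<Rightarrow> real) set \<Rightarrow> point topology" where
  "ring_space R = subtopology (powertop_real UNIV) (powertop_real UNIV closure_of range (ev R))"

definition admissible :: "(nat \<Rightarrow> real) set \<Rightarrow> bool" where
  "admissible R \<longleftrightarrow> (\<forall>f\<in>R. bounded (range f)) \<and> (\<forall>n. indicator {n} \<in> R)"

lemma admissible_UN:
  assumes "I \<noteq> {}" "\<And>i. i \<in> I \<Longrightarrow> admissible (R i)"
  shows "admissible (\<Union>i\<in>I. R i)"
  unfolding admissible_def
proof (intro conjI ballI allI)
  show "bounded (range f)" if "f \<in> (\<Union>i\<in>I. R i)" for f
    using that assms(2) unfolding admissible_def by blast
  show "indicator {n} \<in> (\<Union>i\<in>I. R i)" for n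
    using assms unfolding admissible_def by blast
qed

lemma topspace_ring_space: "topspace (ring_space R) = powertop_real UNIV closure_of range (ev R)"
  unfolding ring_space_def by (simp add: topspace_subtopology)

lemma ev_in_ring_space: "ev R n \<in> topspace (ring_space R)"
  unfolding topspace_ring_space
  using closure_of_subset[of "range (ev R)" "powertop_real UNIV"] by auto

lemma continuous_map_coordinate: "continuous_map (ring_space R) euclideanreal (\<lambda>z. z f)"
  unfolding ring_space_def
  by (intro continuous_map_from_subtopology continuous_map_product_projection) auto

lemma ring_space_Hausdorff: "Hausdorff_space (ring_space R)"
  unfolding ring_space_def by (auto intro!: Hausdorff_space_subtopology simp: Hausdorff_space_product_topology)

text \<open>The coordinate \<open>f\<close> is continuous and vanishes at every
  \<open>ev R n\<close>, hence on the closure. So distinct points of \<open>ring_space R\<close>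
  already differ in a coordinate from \<open>R\<close>.\<close>

lemma ring_space_outside:
  assumes "z \<in> topspace (ring_space R)" "f \<notin> R"
  shows "z f = 0"
proof -
  have z: "z \<in> powertop_real UNIV closure_of range (ev R)"
    using assms by (simp add: topspace_ring_space)
  have c: "continuous_map (powertop_real UNIV) euclideanreal (\<lambda>z. z f)"
    by (rule continuous_map_product_projection) simp
  show ?thesis
    by (rule forall_in_closure_of_eq[OF z _ c, of "\<lambda>_. 0"]) (use assms(2) in \<open>simp_all add: ev_def image_iff\<close>, fastforce)
qed

text \<open>The bounds of the functions give a box that is compact by Tychonoff and contains the
  closure.\<close>

lemma ring_space_compact:
  assumes "\<And>f. f \<in> R \<Longrightarrow> bounded (range f)"
  shows "compact_space (ring_space R)"
proof -
  have "\<exists>b. \<forall>n. \<bar>ev R n f\<bar> \<le> b" for f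
  proof (cases "f \<in> R")
    case True
    with assms[OF True] show ?thesis by (auto simp: ev_def bounded_iff)
  qed (auto simp: ev_def)
  then obtain b where b: "\<And>f n. \<bar>ev R n f\<bar> \<le> b f" by metis
  let ?K = "PiE UNIV (\<lambda>f. {-b f..b f}) :: point set"
  have K: "compactin (powertop_real UNIV) ?K"
    by (simp add: compactin_PiE)
  then have "closedin (powertop_real UNIV) ?K"
    by (rule compactin_imp_closedin[rotated]) (auto simp: Hausdorff_space_product_topology)
  moreover have "range (ev R) \<subseteq> ?K"
    using b by (auto simp: abs_le_iff) (metis minus_le_iff)
  ultimately have "powertop_real UNIV closure_of range (ev R) \<subseteq> ?K"
    by (simp add: closure_of_minimal)
  then have "compactin (powertop_real UNIV) (powertop_real UNIV closure_of range (ev R))"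
    using K closed_compactin closedin_closure_of by blast
  then show ?thesis
    unfolding ring_space_def by (simp add: compact_space_subtopology)
qed

text \<open>The coordinate \<open>indicator {n}\<close> is 1 at \<open>ev R n\<close> and 0 at the
  other embedded points. This makes \<open>ev R\<close> injective, and the condition that the
  coordinate exceed 1/2 isolates \<open>ev R n\<close> in the image.\<close>

lemma compactification_ring_space:
  assumes "admissible R"
  shows "compactification (ring_space R, ev R)"
proof -
  have ind: "indicator {n} \<in> R" for n using assms by (auto simp: admissible_def)
  have sep: "ev R m (indicator {n}) = (if m = n then 1 else 0)" for m n
    using ind by (auto simp: ev_def indicator_def)
  have inj: "inj (ev R)"
    by (rule injI) (metis sep zero_neq_one)
  have op: "openin (subtopology (ring_space R) (range (ev R))) (ev R ` A)" for A
  proof -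
    let ?V = "\<lambda>n. {z \<in> topspace (ring_space R). z (indicator {n}) \<in> {1/2<..}}"
    have "openin (ring_space R) (?V n)" for n
      by (intro openin_continuous_map_preimage[where Y = euclideanreal] continuous_map_coordinate) auto
    then have "openin (ring_space R) (\<Union>n\<in>A. ?V n)" by blast
    moreover have "ev R ` A = (\<Union>n\<in>A. ?V n) \<inter> range (ev R)"
      using ev_in_ring_space by (fastforce simp: sep split: if_splits)
    ultimately show ?thesis by (auto simp: openin_subtopology)
  qed
  have "embedding_map (discrete_topology UNIV) (ring_space R) (ev R)"
    unfolding embedding_map_def
  proof (rule bijective_open_imp_homeomorphic_map)
    show "continuous_map (discrete_topology UNIV) (subtopology (ring_space R) (ev R ` topspace (discrete_topology UNIV))) (ev R)"
      using ev_in_ring_space by (auto simp: continuous_map_in_subtopology)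
    show "open_map (discrete_topology UNIV) (subtopology (ring_space R) (ev R ` topspace (discrete_topology UNIV))) (ev R)"
      using op by (auto simp: open_map_def)
    show "ev R ` topspace (discrete_topology UNIV) = topspace (subtopology (ring_space R) (ev R ` topspace (discrete_topology UNIV)))"
      using ev_in_ring_space by auto
  qed (use inj in auto)
  moreover have "ring_space R closure_of range (ev R) = topspace (ring_space R)"
    unfolding topspace_ring_space
    unfolding ring_space_def by (simp add: closure_of_subtopology Int_absorb1 closure_of_subset)
  ultimately show ?thesis
    using assms ring_space_compact[of R] ring_space_Hausdorff
    by (auto simp: compactification_def admissible_def)
qed

text \<open>Uniform continuity with finitely many members of \<open>R\<close> as modulus. The pairs
  at which \<open>g\<close> differs by at least \<epsilon> form a compact set off the diagonal, so
  finitely many sets of pairs on which some \<open>h\<close> differs by more than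
  \<open>1 / (k + 1)\<close> cover it. This serves both to compute the Higson rings and to pass to
  finitely many metrics.\<close>

lemma ring_space_uniform:
  assumes bd: "\<And>f. f \<in> R \<Longrightarrow> bounded (range f)"
    and g: "continuous_map (ring_space R) euclideanreal g" and "\<epsilon> > 0"
  obtains H \<delta> where "finite H" "H \<subseteq> R" "\<delta> > 0"
    "\<And>m n. (\<And>h. h \<in> H \<Longrightarrow> \<bar>h m - h n\<bar> < \<delta>) \<Longrightarrow> \<bar>g (ev R m) - g (ev R n)\<bar> < \<epsilon>"
proof -
  let ?X = "ring_space R" and ?Y = "prod_topology (ring_space R) (ring_space R)"
  have cf: "continuous_map ?Y euclideanreal (\<lambda>p. \<bar>u (fst p) - u (snd p)\<bar>)"
    if "continuous_map ?X euclideanreal u" for u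
    using that
    by (intro continuous_map_real_abs continuous_map_diff)
       (auto intro: continuous_map_compose[OF continuous_map_fst, unfolded o_def]
          continuous_map_compose[OF continuous_map_snd, unfolded o_def])
  define C where "C = {p \<in> topspace ?Y. \<bar>g (fst p) - g (snd p)\<bar> \<in> {\<epsilon>..}}"
  have "closedin ?Y C"
    unfolding C_def by (intro closedin_continuous_map_preimage[where Y = euclideanreal] cf g) auto
  then have C: "compactin ?Y C"
    using ring_space_compact[OF bd] by (intro closedin_compact_space) (auto simp: compact_space_prod_topology)
  define Ob where "Ob = (\<lambda>h k. {p \<in> topspace ?Y. \<bar>fst p h - snd p h\<bar> \<in> {inverse (real (Suc k))<..}})"
  have op: "openin ?Y (Ob h k)" for h k
    unfolding Ob_def by (intro openin_continuous_map_preimage[where Y = euclideanreal] cf continuous_map_coordinate) auto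
  have cov: "C \<subseteq> \<Union>((\<lambda>(h,k). Ob h k) ` (R \<times> UNIV))"
  proof
    fix p assume "p \<in> C"
    then have p: "fst p \<in> topspace ?X" "snd p \<in> topspace ?X" "fst p \<noteq> snd p" "p \<in> topspace ?Y"
      using \<open>\<epsilon> > 0\<close> by (auto simp: C_def)
    then obtain h where h: "fst p h \<noteq> snd p h" by auto
    with p have "h \<in> R" using ring_space_outside by metis
    obtain k where "inverse (real (Suc k)) < \<bar>fst p h - snd p h\<bar>"
      using h reals_Archimedean[of "\<bar>fst p h - snd p h\<bar>"] by auto
    then show "p \<in> \<Union>((\<lambda>(h,k). Ob h k) ` (R \<times> UNIV))"
      using p \<open>h \<in> R\<close> by (auto simp: Ob_def)
  qed
  obtain \<F> where F: "finite \<F>" "\<F> \<subseteq> (\<lambda>(h,k). Ob h k) ` (R \<times> UNIV)" "C \<subseteq> \<Union>\<F>"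
    using compactinD[OF C _ cov] op by (metis (no_types, lifting) imageE case_prod_beta)
  then obtain T where T: "finite T" "T \<subseteq> R \<times> UNIV" "\<F> = (\<lambda>(h,k). Ob h k) ` T"
    by (meson finite_subset_image)
  \<comment> \<open>The \<open>1\<close> keeps the minimum meaningful when \<open>T\<close> is
    empty.\<close>
  define \<delta> where "\<delta> = Min (insert 1 ((\<lambda>(h,k). inverse (real (Suc k))) ` T))"
  have "\<delta> > 0" unfolding \<delta>_def using T(1) by (auto simp: Min_gr_iff)
  have le: "\<delta> \<le> inverse (real (Suc k))" if "(h,k) \<in> T" for h k
    unfolding \<delta>_def using T(1) that by (intro Min_le) force+
  show thesis
  proof (rule that[of "fst ` T" \<delta>])
    fix m n assume a: "\<And>h. h \<in> fst ` T \<Longrightarrow> \<bar>h m - h n\<bar> < \<delta>"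
    show "\<bar>g (ev R m) - g (ev R n)\<bar> < \<epsilon>"
    proof (rule ccontr)
      assume "\<not> ?thesis"
      then have "(ev R m, ev R n) \<in> C" using ev_in_ring_space by (auto simp: C_def)
      then obtain h k where hk: "(h,k) \<in> T" "(ev R m, ev R n) \<in> Ob h k" using F T by auto
      then have "h \<in> R" using T by auto
      with hk have "inverse (real (Suc k)) < \<bar>h m - h n\<bar>"
        by (auto simp: Ob_def ev_def)
      moreover have "\<bar>h m - h n\<bar> < \<delta>" using a hk(1) by force
      ultimately show False using le[OF hk(1)] by linarith
    qed
  qed (use T(1,2) \<open>\<delta> > 0\<close> in auto)
qed

section \<open>Comparing compactifications by their rings of functions\<close>

lemma ext_ring_bounded: "f \<in> ext_ring K \<Longrightarrow> bounded (range f)"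
  by (auto simp: ext_ring_def)

lemma ring_subset_ext_ring:
  assumes "\<And>f. f \<in> R \<Longrightarrow> bounded (range f)"
  shows "R \<subseteq> ext_ring (ring_space R, ev R)"
proof
  fix f assume "f \<in> R"
  then show "f \<in> ext_ring (ring_space R, ev R)"
    using assms[of f] continuous_map_coordinate[of R f]
    by (auto simp: ext_ring_def ev_def intro!: exI[of _ "\<lambda>z. z f"])
qed

lemma ext_ring_mono:
  assumes "cptf_le K L"
  shows "ext_ring K \<subseteq> ext_ring L"
proof -
  obtain X e Y e' where KL: "K = (X, e)" "L = (Y, e')" by fastforce
  obtain \<phi> where \<phi>: "continuous_map Y X \<phi>" "\<And>n. \<phi> (e' n) = e n"
    using assms by (auto simp: cptf_le_def KL)
  show ?thesis
  proof
    fix f assume "f \<in> ext_ring K"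
    then obtain g where "continuous_map X euclideanreal g" "\<And>n. g (e n) = f n" "bounded (range f)"
      by (auto simp: ext_ring_def KL)
    then show "f \<in> ext_ring L"
      using \<phi> continuous_map_compose[OF \<phi>(1), of euclideanreal g]
      by (auto simp: ext_ring_def KL intro!: exI[of _ "g \<circ> \<phi>"])
  qed
qed

lemma cptf_le_trans:
  assumes "cptf_le K L" "cptf_le L M"
  shows "cptf_le K M"
proof -
  obtain X e Y e' Z e'' where KLM: "K = (X, e)" "L = (Y, e')" "M = (Z, e'')" by (metis prod.exhaust)
  obtain \<phi> where \<phi>: "continuous_map Y X \<phi>" "\<phi> ` topspace Y = topspace X" "\<And>n. \<phi> (e' n) = e n"
    using assms(1) by (auto simp: cptf_le_def KLM)
  obtain \<psi> where \<psi>: "continuous_map Z Y \<psi>" "\<psi> ` topspace Z = topspace Y" "\<And>n. \<psi> (e'' n) = e' n"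
    using assms(2) by (auto simp: cptf_le_def KLM)
  have "continuous_map Z X (\<phi> \<circ> \<psi>)" using \<psi>(1) \<phi>(1) by (rule continuous_map_compose)
  moreover have "(\<phi> \<circ> \<psi>) ` topspace Z = topspace X" by (simp only: image_comp[symmetric] \<phi>(2) \<psi>(2))
  moreover have "(\<phi> \<circ> \<psi>) (e'' n) = e n" for n by (simp add: \<phi>(3) \<psi>(3))
  ultimately show ?thesis unfolding cptf_le_def KLM by blast
qed

lemma cptf_point:
  assumes "compactification (X, e)"
  shows "e n \<in> topspace X"
proof -
  have "homeomorphic_map (discrete_topology UNIV) (subtopology X (range e)) e"
    using assms by (simp add: compactification_def embedding_map_def)
  from homeomorphic_imp_surjective_map[OF this]
  have "range e = topspace (subtopology X (range e))" by (simp only: topspace_discrete_topology)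
  then show ?thesis by (metis IntE rangeI topspace_subtopology)
qed

text \<open>The extensions of the members of \<open>R\<close> are the coordinates of \<phi>. The
  image is compact, hence closed, and contains the points \<open>ev R n\<close>, so it is the whole
  space. Density of \<omega> makes extensions unique, which allows any \<open>g\<close> in the last
  conclusion.\<close>

lemma ring_map:
  assumes K: "compactification (X, e)" and R: "R \<subseteq> ext_ring (X, e)"
  obtains \<phi> where "continuous_map X (ring_space R) \<phi>" "\<phi> ` topspace X = topspace (ring_space R)"
    "\<And>n. \<phi> (e n) = ev R n" "\<And>f g z. \<lbrakk>f \<in> R; continuous_map X euclideanreal g;
        \<And>n. g (e n) = f n; z \<in> topspace X\<rbrakk> \<Longrightarrow> \<phi> z f = g z"
proof -
  have cK: "compact_space X" "X closure_of range e = topspace X" using K by (auto simp: compactification_def)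
  have "\<exists>g. continuous_map X euclideanreal g \<and> (\<forall>n. g (e n) = f n)" if "f \<in> R" for f
    using that R by (auto simp: ext_ring_def)
  then obtain G where G: "\<And>f. f \<in> R \<Longrightarrow> continuous_map X euclideanreal (G f)"
      "\<And>f n. f \<in> R \<Longrightarrow> G f (e n) = f n" by metis
  define \<phi> where "\<phi> z = (\<lambda>f. if f \<in> R then G f z else 0)" for z
  have e: "\<phi> (e n) = ev R n" for n by (auto simp: \<phi>_def ev_def G)
  have c: "continuous_map X (powertop_real UNIV) \<phi>"
    unfolding continuous_map_componentwise_UNIV
  proof
    fix f show "continuous_map X euclideanreal (\<lambda>x. \<phi> x f)"
      by (cases "f \<in> R") (auto simp: \<phi>_def G intro: G)
  qed
  have im: "\<phi> ` topspace X = topspace (ring_space R)"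
  proof
    have "\<phi> ` (X closure_of range e) \<subseteq> powertop_real UNIV closure_of (\<phi> ` range e)"
      using c continuous_map_image_closure_subset by blast
    then show "\<phi> ` topspace X \<subseteq> topspace (ring_space R)"
      by (simp add: cK topspace_ring_space image_image e)
    have "closedin (powertop_real UNIV) (\<phi> ` topspace X)"
      using cK(1) c by (intro compactin_imp_closedin image_compactin[of X])
         (auto simp: Hausdorff_space_product_topology compact_space_def)
    moreover have "range (ev R) \<subseteq> \<phi> ` topspace X"
      using e cptf_point[OF K] by (metis image_subsetI imageI)
    ultimately show "topspace (ring_space R) \<subseteq> \<phi> ` topspace X"
      by (simp add: topspace_ring_space closure_of_minimal)
  qed
  show thesis
  proof (rule that[OF _ im])
    show "continuous_map X (ring_space R) \<phi>"
      using c im unfolding ring_space_def topspace_ring_space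
      by (auto simp: continuous_map_in_subtopology topspace_ring_space)
    fix f g z assume f: "f \<in> R" and g: "continuous_map X euclideanreal g" "\<And>n. g (e n) = f n" and z: "z \<in> topspace X"
    have "G f z = g z"
      by (rule forall_in_closure_of_eq[of z X "range e" euclideanreal]) (use f g z G cK in auto)
    then show "\<phi> z f = g z" using f by (simp add: \<phi>_def)
  qed (rule e)
qed

lemma ring_space_le:
  assumes "compactification K" and "R \<subseteq> ext_ring K"
  shows "cptf_le (ring_space R, ev R) K"
proof -
  obtain X e where K: "K = (X, e)" by fastforce
  obtain \<phi> where "continuous_map X (ring_space R) \<phi>" "\<phi> ` topspace X = topspace (ring_space R)"
    "\<And>n. \<phi> (e n) = ev R n"
    using ring_map[OF assms[unfolded K]] by metis
  then show ?thesis unfolding K cptf_le_def by auto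
qed

text \<open>By Urysohn's lemma the functions in \<open>ext_ring K\<close> separate the points of
  \<open>K\<close>. So the canonical map onto the generated space is injective, hence a
  homeomorphism by compactness, and its inverse is the required map.\<close>

lemma le_ring_space_ext_ring:
  assumes "compactification K"
  shows "cptf_le K (ring_space (ext_ring K), ev (ext_ring K))"
proof -
  obtain X e where K: "K = (X, e)" by fastforce
  let ?R = "ext_ring K"
  have cK: "compact_space X" "Hausdorff_space X" using assms by (auto simp: compactification_def K)
  obtain \<phi> where \<phi>: "continuous_map X (ring_space ?R) \<phi>" "\<phi> ` topspace X = topspace (ring_space ?R)"
    "\<And>n. \<phi> (e n) = ev ?R n" "\<And>f g z. \<lbrakk>f \<in> ?R; continuous_map X euclideanreal g;
        \<And>n. g (e n) = f n; z \<in> topspace X\<rbrakk> \<Longrightarrow> \<phi> z f = g z"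
    using ring_map[OF assms[unfolded K] order_refl] unfolding K by metis
  have "inj_on \<phi> (topspace X)"
  proof (rule inj_onI, rule ccontr)
    fix z w assume zw: "z \<in> topspace X" "w \<in> topspace X" "\<phi> z = \<phi> w" "z \<noteq> w"
    have cl: "closedin X {z}" "closedin X {w}"
      by (simp_all add: closedin_Hausdorff_sing_eq[OF cK(2)] zw)
    have "normal_space X" using cK by (simp add: compact_Hausdorff_or_regular_imp_normal_space)
    moreover have "disjnt {z} {w}" using zw(4) by simp
    ultimately obtain g where g: "continuous_map X (top_of_set {0..1::real}) g" "g ` {z} \<subseteq> {0}" "g ` {w} \<subseteq> {1}"
      using Urysohn_lemma[OF _ cl _ zero_le_one] by metis
    have gc: "continuous_map X euclideanreal g" "\<And>x. x \<in> topspace X \<Longrightarrow> g x \<in> {0..1}"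
      using g(1) by (auto simp: continuous_map_in_subtopology)
    have "bounded (range (g \<circ> e))"
      using gc(2) cptf_point[of X e] assms unfolding K by (intro boundedI[of _ 1]) fastforce
    then have "g \<circ> e \<in> ?R" using gc(1) by (auto simp: K ext_ring_def)
    then have "\<phi> x (g \<circ> e) = g x" if "x \<in> topspace X" for x
      using \<phi>(4)[of "g \<circ> e" g x] gc(1) that by simp
    from this[OF zw(1)] this[OF zw(2)] show False using zw(3) g by simp
  qed
  then have "homeomorphic_map X (ring_space ?R) \<phi>"
    using continuous_imp_homeomorphic_map[OF \<phi>(1) cK(1) ring_space_Hausdorff \<phi>(2)] by auto
  then obtain \<psi> where \<psi>: "homeomorphic_maps X (ring_space ?R) \<phi> \<psi>"
    by (auto simp: homeomorphic_map_maps)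
  then have "\<psi> (ev ?R n) = e n" for n
    using \<phi>(3) cptf_point[of X e n] assms unfolding K homeomorphic_maps_def by metis
  moreover have "continuous_map (ring_space ?R) X \<psi>" using \<psi> by (auto simp: homeomorphic_maps_def)
  moreover have "\<psi> ` topspace (ring_space ?R) = topspace X"
    using \<psi> homeomorphic_imp_surjective_map homeomorphic_maps_map homeomorphic_maps_sym by metis
  ultimately show ?thesis unfolding K cptf_le_def by auto
qed

text \<open>The space generated by \<open>ext_ring K\<close> lies in between. Together with
  \<open>ring_space_le\<close> this reduces comparisons to inclusions of families of
  functions.\<close>

lemma le_ring_space:
  assumes "compactification K" "ext_ring K \<subseteq> R" "admissible R"
  shows "cptf_le K (ring_space R, ev R)"
proof -
  have "R \<subseteq> ext_ring (ring_space R, ev R)"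
    using assms(3) by (intro ring_subset_ext_ring) (auto simp: admissible_def)
  then have "cptf_le (ring_space (ext_ring K), ev (ext_ring K)) (ring_space R, ev R)"
    using assms by (intro ring_space_le compactification_ring_space) auto
  then show ?thesis using le_ring_space_ext_ring[OF assms(1)] cptf_le_trans by blast
qed

text \<open>Indicators of points extend because \<open>\<omega>\<close> is open in each of its compactifications.\<close>

lemma admissible_ext_ring:
  assumes "compactification K"
  shows "admissible (ext_ring K)"
proof -
  obtain X e where K: "K = (X, e)" by fastforce
  have cK: "Hausdorff_space X" "X closure_of range e = topspace X"
     "embedding_map (discrete_topology UNIV) X e" using assms by (auto simp: compactification_def K)
  have et: "e m \<in> topspace X" for m using cptf_point assms K by blast
  have hom: "homeomorphic_map (discrete_topology UNIV) (subtopology X (range e)) e"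
    using cK(3) by (simp add: embedding_map_def)
  have inj: "inj e" using homeomorphic_imp_injective_map[OF hom] by simp
  have "indicator {n} \<in> ext_ring (X, e)" for n
  proof -
    have "openin (subtopology X (range e)) (e ` {n})"
      using homeomorphic_map_openness[OF hom, of "{n}"] by simp
    then obtain V where V: "openin X V" "{e n} = V \<inter> range e" by (auto simp: openin_subtopology)
    have n: "closedin X {e n}" using et cK(1) by (simp add: closedin_Hausdorff_sing_eq)
    \<comment> \<open>Apart from \<open>e n\<close> the open set \<open>V\<close> misses the dense
      range, so it has no other point and \<open>e n\<close> is isolated in
      \<open>X\<close>.\<close>
    then have V': "openin X (V - {e n})" using V by (simp add: openin_diff)
    moreover have "(V - {e n}) \<inter> range e = {}" using V by auto
    ultimately have "(V - {e n}) \<inter> topspace X = {}"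
      using openin_Int_closure_of_eq_empty[OF V', of "range e"] cK(2) by simp
    then have "V - {e n} = {}" using openin_subset[OF V'] by blast
    then have "V = {e n}" using V(2) by blast
    then have o: "openin X {e n}" using V(1) by simp
    have "continuous_map X euclideanreal (indicator {e n})"
    proof -
      have "{x \<in> topspace X. indicator {e n} x \<in> U} =
         (if 1 \<in> U then {e n} else {}) \<union> (if (0::real) \<in> U then topspace X - {e n} else {})" for U
        using et by (auto simp: indicator_def split: if_splits)
      then show ?thesis using o n et by (auto simp: continuous_map_def openin_diff insert_absorb)
    qed
    moreover have "indicator {e n} (e m) = (indicator {n} m :: real)" for m
      using inj by (auto simp: indicator_def inj_def)
    moreover have "bounded (range (indicator {n} :: nat \<Rightarrow> real))"
      by (intro boundedI[of _ 1]) (auto simp: indicator_def)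
    ultimately show ?thesis by (auto simp: ext_ring_def)
  qed
  then show ?thesis by (auto simp: admissible_def K ext_ring_bounded)
qed

section \<open>Existence of the largest compactification and of suprema\<close>

lemma beta_omega_spec: "compactification beta_omega \<and> (\<forall>L :: point cptf. compactification L \<longrightarrow> cptf_le L beta_omega)"
  unfolding beta_omega_def
proof (rule someI_ex, intro exI conjI allI impI)
  \<comment> \<open>The bounded functions contain every \<open>ext_ring L\<close>, so they generate
    a largest compactification.\<close>
  let ?R = "{f :: nat \<Rightarrow> real. bounded (range f)}"
  have "bounded (range (indicator {n} :: nat \<Rightarrow> real))" for n
    by (intro boundedI[of _ 1]) (auto simp: indicator_def)
  then have R: "admissible ?R" by (auto simp: admissible_def)
  then show "compactification (ring_space ?R, ev ?R)" by (rule compactification_ring_space)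
  fix L :: "point cptf" assume "compactification L"
  then show "cptf_le L (ring_space ?R, ev ?R)"
    by (intro le_ring_space R) (auto simp: ext_ring_bounded)
qed

lemma ext_ring_beta_omega: "ext_ring beta_omega = {f. bounded (range f)}"
proof -
  let ?R = "{f :: nat \<Rightarrow> real. bounded (range f)}"
  have "bounded (range (indicator {n} :: nat \<Rightarrow> real))" for n
    by (intro boundedI[of _ 1]) (auto simp: indicator_def)
  then have "compactification (ring_space ?R, ev ?R)"
    by (intro compactification_ring_space) (auto simp: admissible_def)
  then have "ext_ring (ring_space ?R, ev ?R) \<subseteq> ext_ring beta_omega"
    using beta_omega_spec ext_ring_mono by blast
  then show ?thesis using ring_subset_ext_ring[of ?R] ext_ring_bounded by blast
qed

text \<open>The union of the rings generates a least upper bound, although it need not be a ring.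
  Since \<open>S\<close> is nonempty, the union contains the indicators of points.\<close>

lemma cptf_sup_spec:
  assumes S: "S \<noteq> {}" "\<And>L. L \<in> S \<Longrightarrow> compactification L"
  shows "compactification (cptf_sup S)" "\<And>L. L \<in> S \<Longrightarrow> cptf_le L (cptf_sup S)"
    "\<And>M :: point cptf. \<lbrakk>compactification M; \<And>L. L \<in> S \<Longrightarrow> cptf_le L M\<rbrakk> \<Longrightarrow> cptf_le (cptf_sup S) M"
proof -
  define R where "R = \<Union>(ext_ring ` S)"
  let ?K = "(ring_space R, ev R)"
  have R: "admissible R"
    unfolding R_def using S(1) admissible_ext_ring[OF S(2)] by (rule admissible_UN)
  have 1: "compactification ?K" by (rule compactification_ring_space[OF R])
  have 2: "cptf_le L ?K" if "L \<in> S" for L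
    using S(2)[OF that] _ R by (rule le_ring_space) (use that in \<open>auto simp: R_def\<close>)
  have 3: "cptf_le ?K M" if M: "compactification M" "\<And>L. L \<in> S \<Longrightarrow> cptf_le L M" for M :: "point cptf"
  proof (rule ring_space_le[OF M(1)])
    show "R \<subseteq> ext_ring M" unfolding R_def using ext_ring_mono[OF M(2)] by blast
  qed
  have "compactification (cptf_sup S) \<and> (\<forall>L\<in>S. cptf_le L (cptf_sup S)) \<and>
        (\<forall>M :: point cptf. compactification M \<and> (\<forall>L\<in>S. cptf_le L M) \<longrightarrow> cptf_le (cptf_sup S) M)"
    unfolding cptf_sup_def by (rule someI[of _ ?K]) (use 1 2 3 in blast)
  then show "compactification (cptf_sup S)" "\<And>L. L \<in> S \<Longrightarrow> cptf_le L (cptf_sup S)"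
    "\<And>M :: point cptf. \<lbrakk>compactification M; \<And>L. L \<in> S \<Longrightarrow> cptf_le L M\<rbrakk> \<Longrightarrow> cptf_le (cptf_sup S) M"
    by blast+
qed

lemma cptf_eq_imp_le: "cptf_eq K L \<Longrightarrow> cptf_le K L"
  unfolding cptf_eq_def cptf_le_def
  by (auto split: prod.splits dest: homeomorphic_imp_continuous_map homeomorphic_imp_surjective_map)

section \<open>Suprema of Higson compactifications\<close>

lemma PM_metric: "d \<in> PM \<Longrightarrow> Metric_space UNIV d"
  by (simp add: PM_def)

text \<open>Closed balls are bounded, and compact sets are finite in the discrete topology.
  Properness enters below only in this form.\<close>

lemma PM_finite_cball:
  assumes "d \<in> PM"
  shows "finite {y. d x y \<le> r}"
proof -
  interpret Metric_space UNIV d using assms by (rule PM_metric)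
  have "mtopology = discrete_topology UNIV" using assms by (simp add: PM_def)
  moreover have "compactin mtopology (mtopology closure_of (mcball x r))"
    using assms mbounded_mcball by (auto simp: PM_def)
  ultimately have "finite (mcball x r)"
    by (simp add: discrete_topology_closure_of compactin_discrete_topology)
  then show ?thesis by (simp add: mcball_def)
qed

lemma higson_ring_bounded: "f \<in> higson_ring d \<Longrightarrow> bounded (range f)"
  by (simp add: higson_ring_def)

lemma slowly_oscillatingI:
  assumes "d \<in> PM"
    and "\<And>r \<epsilon>. \<epsilon> > 0 \<Longrightarrow> \<exists>K. finite K \<and> (\<forall>x\<in>-K. \<forall>y. d x y < r \<longrightarrow> \<bar>f x - f y\<bar> \<le> \<epsilon>)"
  shows "slowly_oscillating d f"
  unfolding slowly_oscillating_def
proof (intro allI impI)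
  interpret Metric_space UNIV d using assms(1) by (rule PM_metric)
  fix r \<epsilon> :: real assume "r > 0" "\<epsilon> > 0"
  \<comment> \<open>Two points of a ball are compared through its centre, which costs a factor 2; a
    third of \<epsilon> leaves a strict inequality.\<close>
  then obtain K where K: "finite K" "\<And>x y. x \<notin> K \<Longrightarrow> d x y < r \<Longrightarrow> \<bar>f x - f y\<bar> \<le> \<epsilon> / 3"
    using assms(2)[of "\<epsilon> / 3" r] by auto
  have "diameter (f ` mball x r) < \<epsilon>" if xK: "x \<notin> K" for x
  proof -
    have "norm (u - v) \<le> 2 * (\<epsilon> / 3)" if uv: "u \<in> f ` mball x r" "v \<in> f ` mball x r" for u v
    proof -
      obtain y z where yz: "u = f y" "v = f z" "d x y < r" "d x z < r" using uv by auto
      show ?thesis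
        unfolding yz(1,2) real_norm_def using K(2)[OF xK yz(3)] K(2)[OF xK yz(4)] by linarith
    qed
    then have "diameter (f ` mball x r) \<le> 2 * (\<epsilon> / 3)"
      using \<open>\<epsilon> > 0\<close> by (intro diameter_le) auto
    then show ?thesis using \<open>\<epsilon> > 0\<close> by linarith
  qed
  then show "\<exists>K. finite K \<and> (\<forall>x\<in>-K. diameter (f ` mball x r) < \<epsilon>)" using K(1) by auto
qed

lemma slowly_oscillatingD:
  assumes "d \<in> PM" "f \<in> higson_ring d" "\<epsilon> > 0"
  obtains K where "finite K" "\<And>x y. x \<notin> K \<Longrightarrow> d x y < r \<Longrightarrow> \<bar>f x - f y\<bar> < \<epsilon>"
proof -
  interpret Metric_space UNIV d using assms(1) by (rule PM_metric)
  have "slowly_oscillating d f" using assms(2) by (simp add: higson_ring_def)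
  \<comment> \<open>The radius in the conclusion is arbitrary, whereas the definition speaks of
    positive radii.\<close>
  moreover have "max r 1 > 0" by simp
  ultimately obtain K where K: "finite K" "\<And>x. x \<notin> K \<Longrightarrow> diameter (f ` mball x (max r 1)) < \<epsilon>"
    unfolding slowly_oscillating_def using \<open>\<epsilon> > 0\<close> by (metis ComplI)
  show thesis
  proof (rule that[OF K(1)])
    fix x y assume "x \<notin> K" "d x y < r"
    \<comment> \<open>Boundedness ensures that the diameter, a real supremum, really bounds the
      distances.\<close>
    have "bounded (f ` mball x (max r 1))"
      using higson_ring_bounded[OF assms(2)] by (rule bounded_subset) auto
    then have "dist (f x) (f y) \<le> diameter (f ` mball x (max r 1))"
      using \<open>d x y < r\<close> by (intro diameter_bounded_bound) auto
    then show "\<bar>f x - f y\<bar> < \<epsilon>" using K(2)[OF \<open>x \<notin> K\<close>] by (simp add: dist_real_def)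
  qed
qed

lemma admissible_higson_ring:
  assumes "d \<in> PM"
  shows "admissible (higson_ring d)"
proof -
  interpret Metric_space UNIV d using assms by (rule PM_metric)
  have "slowly_oscillating d (indicator {n})" for n
  proof (rule slowly_oscillatingI[OF assms])
    fix r \<epsilon> :: real assume "\<epsilon> > 0"
    have "\<bar>indicator {n} x - indicator {n} y :: real\<bar> \<le> \<epsilon>" if "x \<notin> insert n {x. d n x \<le> r}" "d x y < r" for x y
      using that commute[of n x] \<open>\<epsilon> > 0\<close> by (auto simp: indicator_def)
    then show "\<exists>K. finite K \<and> (\<forall>x\<in>-K. \<forall>y. d x y < r \<longrightarrow> \<bar>indicator {n} x - indicator {n} y :: real\<bar> \<le> \<epsilon>)"
      using PM_finite_cball[OF assms] by (intro exI[of _ "insert n {x. d n x \<le> r}"]) blast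
  qed
  moreover have "bounded (range (indicator {n} :: nat \<Rightarrow> real))" for n
    by (intro boundedI[of _ 1]) (auto simp: indicator_def)
  ultimately show ?thesis by (auto simp: admissible_def higson_ring_def)
qed

text \<open>An extendable function varies little wherever finitely many suitable members of the ring
  vary little, so it inherits slow oscillation from them.\<close>

lemma ext_ring_higson_ring:
  assumes "d \<in> PM"
  shows "ext_ring (ring_space (higson_ring d), ev (higson_ring d)) = higson_ring d" (is "ext_ring (ring_space ?R, _) = _")
proof
  show "?R \<subseteq> ext_ring (ring_space ?R, ev ?R)"
    by (rule ring_subset_ext_ring) (rule higson_ring_bounded)
  show "ext_ring (ring_space ?R, ev ?R) \<subseteq> ?R"
  proof
    fix f assume f: "f \<in> ext_ring (ring_space ?R, ev ?R)"
    then obtain g where g: "continuous_map (ring_space ?R) euclideanreal g" "\<And>n. g (ev ?R n) = f n"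
      by (auto simp: ext_ring_def)
    have "slowly_oscillating d f"
    proof (rule slowly_oscillatingI[OF assms])
      fix r \<epsilon> :: real assume "\<epsilon> > 0"
      obtain H \<delta> where H: "finite H" "H \<subseteq> ?R" "\<delta> > 0"
        "\<And>m n. (\<And>h. h \<in> H \<Longrightarrow> \<bar>h m - h n\<bar> < \<delta>) \<Longrightarrow> \<bar>g (ev ?R m) - g (ev ?R n)\<bar> < \<epsilon>"
        using ring_space_uniform[OF higson_ring_bounded[of _ d] g(1) \<open>\<epsilon> > 0\<close>] by metis
      have "\<exists>K. finite K \<and> (\<forall>x y. x \<notin> K \<longrightarrow> d x y < r \<longrightarrow> \<bar>h x - h y\<bar> < \<delta>)" if "h \<in> H" for h
      proof -
        have "h \<in> ?R" using that H(2) by auto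
        from slowly_oscillatingD[OF assms this H(3), of r] show ?thesis by metis
      qed
      then obtain K where K: "\<And>h. h \<in> H \<Longrightarrow> finite (K h)"
         "\<And>h x y. h \<in> H \<Longrightarrow> x \<notin> K h \<Longrightarrow> d x y < r \<Longrightarrow> \<bar>h x - h y\<bar> < \<delta>" by metis
      have "\<bar>f x - f y\<bar> \<le> \<epsilon>" if "x \<notin> (\<Union>h\<in>H. K h)" "d x y < r" for x y
        using H(4)[of x y] K(2)[of _ x y] that unfolding g(2) by fastforce
      then show "\<exists>K. finite K \<and> (\<forall>x\<in>-K. \<forall>y. d x y < r \<longrightarrow> \<bar>f x - f y\<bar> \<le> \<epsilon>)"
        using H(1) K(1) by (intro exI[of _ "\<Union>h\<in>H. K h"]) blast
    qed
    then show "f \<in> ?R" using ext_ring_bounded[OF f] by (simp add: higson_ring_def)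
  qed
qed

lemma higson_spec:
  assumes "d \<in> PM"
  shows "compactification (higson d)" "ext_ring (higson d) = higson_ring d"
  using someI_ex[of "\<lambda>K. compactification K \<and> ext_ring K = higson_ring d"]
    compactification_ring_space[OF admissible_higson_ring[OF assms]] ext_ring_higson_ring[OF assms]
  unfolding higson_def by blast+

text \<open>For disjoint sets and \<open>d \<in> PM\<close> this is equivalent to having disjoint
  closures in the Higson compactification; \<open>asym_disjoint_function\<close> gives the direction
  from finiteness to separation.\<close>

definition asym_disjoint :: "(nat \<Rightarrow> nat \<Rightarrow> real) \<Rightarrow> nat set \<Rightarrow> nat set \<Rightarrow> bool" where
  "asym_disjoint d P Q \<longleftrightarrow> (\<forall>r. finite {(x, y). x \<in> P \<and> y \<in> Q \<and> d x y \<le> r})"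

text \<open>\<open>separated_by F A\<close> says that \<open>A\<close> and its complement have disjoint closures in
  the supremum of the Higson compactifications of the metrics in \<open>F\<close>.\<close>

definition separated_by :: "(nat \<Rightarrow> nat \<Rightarrow> real) set \<Rightarrow> nat set \<Rightarrow> bool" where
  "separated_by F A \<longleftrightarrow> (\<exists>\<P> \<Q>. finite \<P> \<and> finite \<Q> \<and> \<Union>\<P> = A \<and> \<Union>\<Q> = - A \<and>
     (\<forall>P\<in>\<P>. \<forall>Q\<in>\<Q>. \<exists>d\<in>F. asym_disjoint d P Q))"

lemma separated_by_mono:
  assumes "separated_by F A" "F \<subseteq> G"
  shows "separated_by G A"
proof -
  obtain \<P> \<Q> where "finite \<P>" "finite \<Q>" "\<Union>\<P> = A" "\<Union>\<Q> = - A"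
    "\<forall>P\<in>\<P>. \<forall>Q\<in>\<Q>. \<exists>d\<in>F. asym_disjoint d P Q"
    using assms(1) unfolding separated_by_def by (elim exE conjE)
  moreover from this(5) have "\<forall>P\<in>\<P>. \<forall>Q\<in>\<Q>. \<exists>d\<in>G. asym_disjoint d P Q"
    using assms(2) by blast
  ultimately show ?thesis unfolding separated_by_def by (intro exI[of _ \<P>] exI[of _ \<Q>] conjI)
qed

lemma nearest_point:
  assumes "d \<in> PM" "P \<noteq> {}"
  shows "\<exists>p\<in>P. \<forall>q\<in>P. d x p \<le> d x q"
proof -
  interpret Metric_space UNIV d using assms(1) by (rule PM_metric)
  obtain p0 where p0: "p0 \<in> P" using assms(2) by blast
  let ?S = "{p \<in> P. d x p \<le> d x p0}"
  have "finite ?S" using PM_finite_cball[OF assms(1), of x "d x p0"] by (rule rev_finite_subset) auto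
  moreover have "p0 \<in> ?S" using p0 by simp
  ultimately obtain p where "p \<in> ?S" "\<forall>q\<in>?S. d x p \<le> d x q"
    using arg_min_if_finite[of ?S "d x"] by (metis (no_types, lifting) empty_iff linorder_le_less_linear)
  then show ?thesis by force
qed

text \<open>With \<open>a\<close> and \<open>b\<close> the distances to \<open>P\<close> and
  \<open>Q\<close>, the function \<open>a / (a + b)\<close> works: its oscillation over a distance
  \<open>t\<close> is at most \<open>t / (a + b)\<close>, and asymptotic disjointness makes
  \<open>a + b\<close> tend to infinity.\<close>

lemma asym_disjoint_function:
  assumes d: "d \<in> PM" and a: "asym_disjoint d P Q" and disj: "P \<inter> Q = {}"
  obtains f where "f \<in> higson_ring d" "\<And>x. x \<in> P \<Longrightarrow> f x = 0" "\<And>x. x \<in> Q \<Longrightarrow> f x = 1"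
proof (cases "P = {} \<or> Q = {}")
  case True
  have "(\<lambda>_. c) \<in> higson_ring d" for c
    unfolding higson_ring_def by (auto intro!: slowly_oscillatingI[OF d] exI[of _ "{}"])
  then show ?thesis using True that[of "\<lambda>_. 0"] that[of "\<lambda>_. 1"] by auto
next
  case False
  interpret Metric_space UNIV d using d by (rule PM_metric)
  obtain p where p: "\<And>x. p x \<in> P" "\<And>x q. q \<in> P \<Longrightarrow> d x (p x) \<le> d x q"
    using nearest_point[OF d, of P] False by metis
  obtain q where q: "\<And>x. q x \<in> Q" "\<And>x z. z \<in> Q \<Longrightarrow> d x (q x) \<le> d x z"
    using nearest_point[OF d, of Q] False by metis
  define a where "a x = d x (p x)" for x
  define b where "b x = d x (q x)" for x
  define f where "f x = a x / (a x + b x)" for x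
  have nn: "a x \<ge> 0" "b x \<ge> 0" for x by (auto simp: a_def b_def)
  have aP: "a x = 0 \<longleftrightarrow> x \<in> P" for x
    unfolding a_def using p(1)[of x] p(2)[of x x] nonneg[of x "p x"] by (metis UNIV_I mdist_zero order_antisym zero)
  have bQ: "b x = 0 \<longleftrightarrow> x \<in> Q" for x
    unfolding b_def using q(1)[of x] q(2)[of x x] nonneg[of x "q x"] by (metis UNIV_I mdist_zero order_antisym zero)
  have pos: "a x + b x > 0" for x
    using nn[of x] aP[of x] bQ[of x] disj by (metis IntI add_nonneg_eq_0_iff add_nonneg_nonneg empty_iff order_le_less)
  have lip: "\<bar>a x - a y\<bar> \<le> d x y" "\<bar>b x - b y\<bar> \<le> d x y" for x y
    unfolding a_def b_def
    using p(1)[of x] p(1)[of y] p(2)[of "p x" y] p(2)[of "p y" x] triangle[of x y "p y"] triangle[of y x "p x"]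
       q(1)[of x] q(1)[of y] q(2)[of "q x" y] q(2)[of "q y" x] triangle[of x y "q y"] triangle[of y x "q x"]
      commute[of x y] by auto
  have osc: "\<bar>f x - f y\<bar> \<le> d x y / (a x + b x)" for x y
  proof -
    \<comment> \<open>Written this way, the Lipschitz bounds on \<open>a\<close> and
      \<open>b\<close> produce the factor \<open>a y + b y\<close>, which cancels.\<close>
    have *: "f x - f y = (b y * (a x - a y) - a y * (b x - b y)) / ((a x + b x) * (a y + b y))"
      using pos[of x] pos[of y] by (simp add: f_def divide_simps) (simp add: algebra_simps)
    have "\<bar>b y * (a x - a y) - a y * (b x - b y)\<bar> \<le> b y * \<bar>a x - a y\<bar> + a y * \<bar>b x - b y\<bar>"
      using nn[of y] by (metis abs_mult abs_of_nonneg abs_triangle_ineq4)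
    also have "\<dots> \<le> b y * d x y + a y * d x y"
      using lip nn by (intro add_mono mult_left_mono) auto
    finally have "\<bar>b y * (a x - a y) - a y * (b x - b y)\<bar> \<le> d x y * (a y + b y)" by (simp add: algebra_simps)
    then have "\<bar>f x - f y\<bar> \<le> (d x y * (a y + b y)) / ((a x + b x) * (a y + b y))"
      unfolding * abs_divide using pos[of x] pos[of y] by (intro frac_le) auto
    then show ?thesis using pos[of y] by simp
  qed
  have "slowly_oscillating d f"
  proof (rule slowly_oscillatingI[OF d])
    fix r \<epsilon> :: real assume "\<epsilon> > 0"
    define s where "s = r / \<epsilon>"
    define K where "K = {x. a x + b x \<le> s}"
    \<comment> \<open>The points of \<open>P\<close> and \<open>Q\<close> nearest to
      \<open>x \<in> K\<close> form one of the finitely many pairs at distance at most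
      \<open>s\<close>, and \<open>x\<close> is within \<open>s\<close> of the first of
      them.\<close>
    have "K \<subseteq> (\<Union>(u,v) \<in> {(u,v). u \<in> P \<and> v \<in> Q \<and> d u v \<le> s}. {x. d u x \<le> s})"
    proof
      fix x assume "x \<in> K"
      then have "d (p x) (q x) \<le> s" "d (p x) x \<le> s"
        using triangle[of "p x" x "q x"] commute[of x "p x"] nonneg[of x "q x"]
        by (auto simp: K_def a_def b_def simp del: nonneg)
      then show "x \<in> (\<Union>(u,v) \<in> {(u,v). u \<in> P \<and> v \<in> Q \<and> d u v \<le> s}. {x. d u x \<le> s})"
        using p(1) q(1) by blast
    qed
    moreover have "finite (\<Union>(u,v) \<in> {(u,v). u \<in> P \<and> v \<in> Q \<and> d u v \<le> s}. {x. d u x \<le> s})"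
      using a PM_finite_cball[OF d] unfolding asym_disjoint_def by auto
    ultimately have "finite K" by (rule finite_subset)
    moreover have "\<bar>f x - f y\<bar> \<le> \<epsilon>" if "x \<notin> K" "d x y < r" for x y
    proof -
      have "d x y / (a x + b x) \<le> r / (a x + b x)" using that pos[of x] by (simp add: divide_right_mono)
      also have "\<dots> \<le> \<epsilon>" using that(1) pos[of x] \<open>\<epsilon> > 0\<close> by (simp add: K_def s_def field_simps)
      finally show ?thesis using osc[of x y] by linarith
    qed
    ultimately show "\<exists>K. finite K \<and> (\<forall>x\<in>-K. \<forall>y. d x y < r \<longrightarrow> \<bar>f x - f y\<bar> \<le> \<epsilon>)" by blast
  qed
  moreover have "bounded (range f)"
  proof (rule boundedI[of _ 1])
    fix v assume "v \<in> range f"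
    then obtain x where v: "v = f x" by blast
    have "0 \<le> f x" "f x \<le> 1"
      using nn[of x] pos[of x] by (simp_all add: f_def divide_le_eq_1)
    then show "norm v \<le> 1" by (simp add: v)
  qed
  moreover have "f x = 0" if "x \<in> P" for x using aP that by (simp add: f_def)
  moreover have "f x = 1" if "x \<in> Q" for x using bQ[of x] that pos[of x] by (simp add: f_def)
  ultimately show ?thesis using that by (simp add: higson_ring_def)
qed

text \<open>The indicator of \<open>A\<close> extends over the supremum, so finitely many functions
  \<open>h\<close> from the Higson rings control it. Rounding their values splits \<open>A\<close>
  and its complement into finitely many classes. Between two classes some \<open>h\<close> keeps a
  gap, and its slow oscillation turns the gap into asymptotic disjointness.\<close>

lemma separated_by_if_beta:
  assumes D: "D \<subseteq> PM" "D \<noteq> {}" and eq: "cptf_eq beta_omega (cptf_sup (higson ` D))"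
  obtains F where "finite F" "F \<subseteq> D" "separated_by F A"
proof -
  define R where "R = (\<Union>d\<in>D. higson_ring d)"
  have c: "\<And>L. L \<in> higson ` D \<Longrightarrow> compactification L" using D higson_spec by blast
  have R: "admissible R"
    unfolding R_def using D admissible_higson_ring by (intro admissible_UN) auto
  have le: "cptf_le (cptf_sup (higson ` D)) (ring_space R, ev R)"
  proof (rule cptf_sup_spec(3)[OF _ c compactification_ring_space[OF R]])
    fix L assume "L \<in> higson ` D"
    then show "cptf_le L (ring_space R, ev R)"
      using D c higson_spec(2) by (intro le_ring_space R) (auto simp: R_def)
  qed (use D in auto)
  have bd: "bounded (range (indicator A :: nat \<Rightarrow> real))"
    by (intro boundedI[of _ 1]) (auto simp: indicator_def)
  then have "indicator A \<in> ext_ring (ring_space R, ev R)"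
    using ext_ring_mono[OF le] ext_ring_mono[OF cptf_eq_imp_le[OF eq]] ext_ring_beta_omega by blast
  then obtain g where g: "continuous_map (ring_space R) euclideanreal g" "\<And>n. g (ev R n) = indicator A n"
    by (auto simp: ext_ring_def)
  obtain H \<delta> where H: "finite H" "H \<subseteq> R" "\<delta> > 0"
    "\<And>m n. (\<And>h. h \<in> H \<Longrightarrow> \<bar>h m - h n\<bar> < \<delta>) \<Longrightarrow> \<bar>g (ev R m) - g (ev R n)\<bar> < 1"
    using ring_space_uniform[OF _ g(1), of 1] R by (auto simp: admissible_def)
  obtain D' where D': "\<And>h. h \<in> H \<Longrightarrow> D' h \<in> D \<and> h \<in> higson_ring (D' h)"
    using H(2) unfolding R_def by (metis UN_E subsetD)
  \<comment> \<open>Points whose \<open>h\<close>-values differ by \<open>\<delta>\<close> have colours whose classes stay \<open>\<delta> / 3\<close> apart under \<open>h\<close>.\<close>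
  define c where "c x = (\<lambda>h\<in>H. \<lfloor>3 * h x / \<delta>\<rfloor>)" for x :: nat
  have "finite ((\<lambda>x. \<lfloor>3 * h x / \<delta>\<rfloor>) ` UNIV)" if "h \<in> H" for h
  proof -
    have "bounded (range h)" using that H(2) R unfolding admissible_def by blast
    then obtain B where B: "\<And>x. \<bar>h x\<bar> \<le> B" by (auto simp: bounded_iff)
    have "(\<lambda>x. \<lfloor>3 * h x / \<delta>\<rfloor>) ` UNIV \<subseteq> {\<lfloor>- (3 * B / \<delta>)\<rfloor>..\<lfloor>3 * B / \<delta>\<rfloor>}"
    proof (intro image_subsetI)
      fix x
      have "- (3 * B / \<delta>) \<le> 3 * h x / \<delta>" "3 * h x / \<delta> \<le> 3 * B / \<delta>"
        using B[of x] H(3) by (auto simp: field_simps abs_le_iff)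
      then show "\<lfloor>3 * h x / \<delta>\<rfloor> \<in> {\<lfloor>- (3 * B / \<delta>)\<rfloor>..\<lfloor>3 * B / \<delta>\<rfloor>}"
        by (auto intro: floor_mono)
    qed
    then show ?thesis using finite_subset by blast
  qed
  then have "finite (PiE H (\<lambda>h. (\<lambda>x. \<lfloor>3 * h x / \<delta>\<rfloor>) ` UNIV))"
    using H(1) by (intro finite_PiE) auto
  moreover have "range c \<subseteq> PiE H (\<lambda>h. (\<lambda>x. \<lfloor>3 * h x / \<delta>\<rfloor>) ` UNIV)" by (auto simp: c_def)
  ultimately have fc: "finite (range c)" by (rule rev_finite_subset)
  define \<P> where "\<P> = (\<lambda>u. {x \<in> A. c x = u}) ` range c"
  define \<Q> where "\<Q> = (\<lambda>u. {x \<in> - A. c x = u}) ` range c"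
  have "separated_by (D' ` H) A"
    unfolding separated_by_def
  \<comment> \<open>Empty classes are dropped so that each class has a representative.\<close>
  proof (rule exI[of _ "\<P> - {{}}"], rule exI[of _ "\<Q> - {{}}"], intro conjI ballI)
    fix P Q assume PQ: "P \<in> \<P> - {{}}" "Q \<in> \<Q> - {{}}"
    then obtain x y where x: "x \<in> A" "P = {z \<in> A. c z = c x}" and y: "y \<in> - A" "Q = {z \<in> - A. c z = c y}"
      unfolding \<P>_def \<Q>_def by blast
    have "\<not> \<bar>g (ev R x) - g (ev R y)\<bar> < 1" using x y by (simp add: g)
    then obtain h where h: "h \<in> H" "\<bar>h x - h y\<bar> \<ge> \<delta>" using H(4)[of x y] by force
    have far: "\<bar>h x' - h y'\<bar> \<ge> \<delta> / 3" if "x' \<in> P" "y' \<in> Q" for x' y'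
    proof -
      have "c x' = c x" "c y' = c y" using that x(2) y(2) by auto
      then have "c x' h = c x h" "c y' h = c y h" by simp_all
      then have e: "\<lfloor>3 * h x' / \<delta>\<rfloor> = \<lfloor>3 * h x / \<delta>\<rfloor>" "\<lfloor>3 * h y' / \<delta>\<rfloor> = \<lfloor>3 * h y / \<delta>\<rfloor>"
        using h(1) by (simp_all add: c_def)
      have scale: "\<bar>3 * u / \<delta> - 3 * v / \<delta>\<bar> = 3 * \<bar>u - v\<bar> / \<delta>" for u v
      proof -
        have "3 * u / \<delta> - 3 * v / \<delta> = (3 / \<delta>) * (u - v)" using H(3) by (simp add: field_simps)
        then have "\<bar>3 * u / \<delta> - 3 * v / \<delta>\<bar> = \<bar>3 / \<delta>\<bar> * \<bar>u - v\<bar>" by (simp only: abs_mult)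
        then show ?thesis using H(3) by simp
      qed
      \<comment> \<open>The rescaled values at the representatives differ by at least 3; replacing
        both points within their classes moves each value by less than 1.\<close>
      have "\<bar>3 * h x / \<delta> - 3 * h y / \<delta>\<bar> \<ge> 3"
        unfolding scale using h(2) H(3) by (simp add: le_divide_eq)
      then have "\<bar>3 * h x' / \<delta> - 3 * h y' / \<delta>\<bar> \<ge> 1" using e by linarith
      then show ?thesis unfolding scale using H(3) by (simp add: le_divide_eq)
    qed
    have dd: "D' h \<in> PM" "h \<in> higson_ring (D' h)" using D'[OF h(1)] D by auto
    have "asym_disjoint (D' h) P Q"
      unfolding asym_disjoint_def
    proof
      fix r
      \<comment> \<open>Slow oscillation is about distances strictly below a bound;
        \<open>r + 1\<close> covers distance \<open>r\<close> itself.\<close>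
      obtain K where K: "finite K" "\<And>x y. x \<notin> K \<Longrightarrow> D' h x y < r + 1 \<Longrightarrow> \<bar>h x - h y\<bar> < \<delta> / 3"
        using slowly_oscillatingD[OF dd, of "\<delta> / 3" "r + 1"] H(3) by auto
      have "{(x, y). x \<in> P \<and> y \<in> Q \<and> D' h x y \<le> r} \<subseteq> (SIGMA x:K. {y. D' h x y \<le> r})"
      proof -
        have "x \<in> K" if xy: "x \<in> P" "y \<in> Q" "D' h x y \<le> r" for x y
          using K(2)[of x y] far[OF xy(1,2)] xy(3) by fastforce
        then show ?thesis by auto
      qed
      then show "finite {(x, y). x \<in> P \<and> y \<in> Q \<and> D' h x y \<le> r}"
        by (rule finite_subset) (use K(1) PM_finite_cball[OF dd(1)] in auto)
    qed
    then show "\<exists>d\<in>D' ` H. asym_disjoint d P Q" using h(1) by blast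
  qed (use fc in \<open>auto simp: \<P>_def \<Q>_def\<close>)
  then show thesis using that[of "D' ` H"] H(1) D' by blast
qed

text \<open>Separation gives each \<open>A\<close> and its complement disjoint closures in the
  supremum. Two points of \<beta>\<omega> with disjoint neighbourhoods lie in the closures of some
  \<open>A\<close> and of its complement, so the canonical map is injective and hence a
  homeomorphism.\<close>

lemma beta_if_separated_by:
  assumes D: "D \<subseteq> PM" "D \<noteq> {}" and sep: "\<And>A. separated_by D A"
  shows "cptf_eq beta_omega (cptf_sup (higson ` D))"
proof -
  have c: "\<And>L. L \<in> higson ` D \<Longrightarrow> compactification L" using D higson_spec by blast
  have ne: "higson ` D \<noteq> {}" using D by simp
  obtain X e where K: "cptf_sup (higson ` D) = (X, e)" by fastforce
  obtain Y e' where Y: "beta_omega = (Y, e')" by fastforce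
  have cX: "compactification (X, e)" using cptf_sup_spec(1)[OF ne c] K by simp
  have cY: "compactification (Y, e')" using beta_omega_spec Y by simp
  obtain \<phi> where \<phi>: "continuous_map Y X \<phi>" "\<phi> ` topspace Y = topspace X" "\<And>n. \<phi> (e' n) = e n"
    using beta_omega_spec cX unfolding Y cptf_le_def by force
  have disj: "X closure_of (e ` A) \<inter> X closure_of (e ` (- A)) = {}" for A
  proof (rule ccontr)
    assume "\<not> ?thesis"
    then obtain z where z: "z \<in> X closure_of (e ` A)" "z \<in> X closure_of (e ` (- A))" by blast
    obtain \<P> \<Q> where PQ: "finite \<P>" "finite \<Q>" "\<Union>\<P> = A" "\<Union>\<Q> = - A"
      "\<And>P Q. P \<in> \<P> \<Longrightarrow> Q \<in> \<Q> \<Longrightarrow> \<exists>d\<in>D. asym_disjoint d P Q"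
      using sep[of A] unfolding separated_by_def by metis
    \<comment> \<open>Closure commutes with finite unions, so \<open>z\<close> is a common limit of
      a single \<open>P\<close> and a single \<open>Q\<close>, on which a Higson function is 0 and
      1.\<close>
    have "X closure_of (e ` A) = (\<Union>P\<in>\<P>. X closure_of (e ` P))"
      unfolding PQ(3)[symmetric] image_Union using PQ(1) by (simp add: closure_of_Union image_image)
    then obtain P where P: "P \<in> \<P>" "z \<in> X closure_of (e ` P)" using z(1) by blast
    have "X closure_of (e ` (- A)) = (\<Union>P\<in>\<Q>. X closure_of (e ` P))"
      unfolding PQ(4)[symmetric] image_Union using PQ(2) by (simp add: closure_of_Union image_image)
    then obtain Q where Q: "Q \<in> \<Q>" "z \<in> X closure_of (e ` Q)" using z(2) by blast
    obtain d where d: "d \<in> D" "asym_disjoint d P Q" using PQ(5)[OF P(1) Q(1)] by blast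
    have "P \<inter> Q = {}" using P Q PQ(3,4) by blast
    then obtain f where f: "f \<in> higson_ring d" "\<And>x. x \<in> P \<Longrightarrow> f x = 0" "\<And>x. x \<in> Q \<Longrightarrow> f x = 1"
      using asym_disjoint_function[of d P Q] d D by blast
    have "cptf_le (higson d) (X, e)" using cptf_sup_spec(2)[OF ne c] K d(1) by auto
    then have "f \<in> ext_ring (X, e)" using ext_ring_mono higson_spec(2)[of d] d(1) D(1) f(1) by blast
    then obtain g where g: "continuous_map X euclideanreal g" "\<And>n. g (e n) = f n" by (auto simp: ext_ring_def)
    have "g z = 0"
      by (rule forall_in_closure_of_eq[OF P(2) _ g(1), of "\<lambda>_. 0"]) (auto simp: g(2) f(2))
    moreover have "g z = 1"
      by (rule forall_in_closure_of_eq[OF Q(2) _ g(1), of "\<lambda>_. 1"]) (auto simp: g(2) f(3))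
    ultimately show False by simp
  qed
  have "inj_on \<phi> (topspace Y)"
  proof (rule inj_onI, rule ccontr)
    fix z w assume zw: "z \<in> topspace Y" "w \<in> topspace Y" "\<phi> z = \<phi> w" "z \<noteq> w"
    have H: "Hausdorff_space Y" "Y closure_of range e' = topspace Y" using cY by (auto simp: compactification_def)
    obtain U V where UV: "openin Y U" "openin Y V" "z \<in> U" "w \<in> V" "disjnt U V"
      using H zw unfolding Hausdorff_space_def by metis
    define A where "A = {n. e' n \<in> U}"
    have zA: "z \<in> Y closure_of (e' ` A)"
    proof -
      have "U \<inter> Y closure_of range e' \<subseteq> Y closure_of (U \<inter> range e')"
        by (rule openin_Int_closure_of_subset[OF UV(1)])
      moreover have "U \<inter> range e' = e' ` A" by (auto simp: A_def)
      ultimately show ?thesis using H(2) zw(1) UV(3) by auto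
    qed
    have wA: "w \<in> Y closure_of (e' ` (- A))"
    proof -
      have "V \<inter> Y closure_of range e' \<subseteq> Y closure_of (V \<inter> range e')"
        by (rule openin_Int_closure_of_subset[OF UV(2)])
      also have "\<dots> \<subseteq> Y closure_of (e' ` (- A))"
        using UV(5) by (intro closure_of_mono) (auto simp: A_def disjnt_iff)
      finally show ?thesis using H(2) zw(2) UV(4) by auto
    qed
    have im: "\<phi> ` (Y closure_of (e' ` B)) \<subseteq> X closure_of (e ` B)" for B
      using continuous_map_image_closure_subset[OF \<phi>(1), of "e' ` B"] by (simp add: image_image \<phi>(3))
    have "\<phi> z \<in> X closure_of (e ` A)" "\<phi> w \<in> X closure_of (e ` (- A))"
      using im[THEN subsetD, OF imageI, OF zA] im[THEN subsetD, OF imageI, OF wA] by auto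
    then show False using disj[of A] zw(3) by auto
  qed
  then have h: "homeomorphic_map Y X \<phi>"
    using \<phi> cX cY by (intro continuous_imp_homeomorphic_map) (auto simp: compactification_def)
  then obtain \<psi> where \<psi>: "homeomorphic_maps Y X \<phi> \<psi>"
    by (auto simp: homeomorphic_map_maps)
  then have "\<psi> (e n) = e' n" for n
    using \<phi>(3) cptf_point[OF cY, of n] unfolding homeomorphic_maps_def by metis
  moreover have "homeomorphic_map X Y \<psi>" using \<psi> homeomorphic_maps_map homeomorphic_maps_sym by blast
  ultimately show ?thesis unfolding K Y cptf_eq_def by auto
qed

section \<open>Colourings at bounded scale\<close>

text \<open>A pair \<open>(C, \<tau>)\<close> prescribes, for every pair of colours, the metric that has to separate
  these colour classes. A set \<open>A\<close> is colourable on \<open>[m, k)\<close> at scale \<open>r\<close> if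
  some colouring achieves this for \<open>A\<close> against its complement.\<close>

definition colourable ::
  "'c set \<Rightarrow> ('c \<Rightarrow> 'c \<Rightarrow> nat \<Rightarrow> nat \<Rightarrow> real) \<Rightarrow> real \<Rightarrow> nat \<Rightarrow> nat \<Rightarrow> nat set \<Rightarrow> bool" where
  "colourable C \<tau> r m k A \<longleftrightarrow>
     (\<exists>c. range c \<subseteq> C \<and> (\<forall>x\<in>{m..<k}. \<forall>y\<in>{m..<k}. x \<in> A \<longrightarrow> y \<notin> A \<longrightarrow> r < \<tau> (c x) (c y) x y))"

lemma colourable_mono:
  assumes "colourable C \<tau> r m k A" "m \<le> m'" "k' \<le> k" "\<And>x. x < k' \<Longrightarrow> x \<in> A' \<longleftrightarrow> x \<in> A"
  shows "colourable C \<tau> r m' k' A'"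
proof -
  obtain c where c: "range c \<subseteq> C"
    "\<And>x y. x \<in> {m..<k} \<Longrightarrow> y \<in> {m..<k} \<Longrightarrow> x \<in> A \<Longrightarrow> y \<notin> A \<Longrightarrow> r < \<tau> (c x) (c y) x y"
    using assms(1) unfolding colourable_def by blast
  have "r < \<tau> (c x) (c y) x y" if "x \<in> {m'..<k'}" "y \<in> {m'..<k'}" "x \<in> A'" "y \<notin> A'" for x y
    using c(2)[of x y] that assms(2-4) by auto
  with c(1) show ?thesis unfolding colourable_def by blast
qed

text \<open>Colours are indices of the pieces, and \<open>t\<close> picks a metric separating two
  pieces. Only finitely many pairs are too close at a given scale. The table \<open>t\<close> is
  extensional so that there are finitely many tables for each \<open>N\<close>.\<close>

lemma separated_by_imp_colourable:
  assumes sep: "separated_by F A" and "F \<noteq> {}"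
  obtains N :: nat and t where "t \<in> {..<N} \<times> {..<N} \<rightarrow>\<^sub>E F"
    "\<And>r. \<exists>m. \<forall>k. colourable {..<N} (\<lambda>i j. t (i, j)) r m k A"
proof -
  obtain \<P> \<Q> where PQ: "finite \<P>" "finite \<Q>" "\<Union>\<P> = A" "\<Union>\<Q> = - A"
    "\<And>P Q. P \<in> \<P> \<Longrightarrow> Q \<in> \<Q> \<Longrightarrow> \<exists>d\<in>F. asym_disjoint d P Q"
    using sep unfolding separated_by_def by metis
  \<comment> \<open>Pairs that are not a piece of \<open>A\<close> against a piece of the complement
    get an arbitrary metric in \<open>F\<close>.\<close>
  have "\<exists>d. d \<in> F \<and> (P \<in> \<P> \<longrightarrow> Q \<in> \<Q> \<longrightarrow> asym_disjoint d P Q)" for P Q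
    using PQ(5)[of P Q] \<open>F \<noteq> {}\<close> by blast
  then obtain D where D: "\<And>P Q. D P Q \<in> F" "\<And>P Q. P \<in> \<P> \<Longrightarrow> Q \<in> \<Q> \<Longrightarrow> asym_disjoint (D P Q) P Q"
    by metis
  define N where "N = card (\<P> \<union> \<Q>)"
  obtain h where h: "bij_betw h (\<P> \<union> \<Q>) {..<N}"
    using ex_bij_betw_finite_nat[of "\<P> \<union> \<Q>"] PQ(1,2) by (auto simp: N_def atLeast0LessThan)
  define g where "g = inv_into (\<P> \<union> \<Q>) h"
  have gh: "g (h S) = S" if "S \<in> \<P> \<union> \<Q>" for S
    unfolding g_def using h that by (meson bij_betw_inv_into_left)
  have "\<exists>S. S \<in> \<P> \<union> \<Q> \<and> x \<in> S \<and> (x \<in> A \<longrightarrow> S \<in> \<P>) \<and> (x \<notin> A \<longrightarrow> S \<in> \<Q>)" for x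
    using PQ(3,4) by (cases "x \<in> A") blast+
  then obtain S where S: "\<And>x. S x \<in> \<P> \<union> \<Q>" "\<And>x. x \<in> S x" "\<And>x. x \<in> A \<Longrightarrow> S x \<in> \<P>" "\<And>x. x \<notin> A \<Longrightarrow> S x \<in> \<Q>"
    by metis
  have hS: "h (S x) < N" for x using h S(1)[of x] by (auto simp: bij_betw_def)
  define t where "t = (\<lambda>(i, j)\<in>{..<N} \<times> {..<N}. D (g i) (g j))"
  show thesis
  proof (rule that[of t N])
    show "t \<in> {..<N} \<times> {..<N} \<rightarrow>\<^sub>E F" unfolding t_def using D(1) by auto
    fix r
    define E where "E = (\<Union>P\<in>\<P>. \<Union>Q\<in>\<Q>. {(x, y). x \<in> P \<and> y \<in> Q \<and> D P Q x y \<le> r})"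
    have "finite E" unfolding E_def using PQ(1,2) D(2) unfolding asym_disjoint_def by blast
    \<comment> \<open>Bounding the first coordinates, the points of \<open>A\<close>, already
      excludes all pairs in \<open>E\<close>.\<close>
    then obtain m where m: "\<And>x. x \<in> fst ` E \<Longrightarrow> x < m"
      using finite_nat_set_iff_bounded[of "fst ` E"] by blast
    have "r < t (h (S x), h (S y)) x y" if xy: "x \<ge> m" "x \<in> A" "y \<notin> A" for x y
    proof -
      have "(x, y) \<notin> E" using m[OF image_eqI[of x fst "(x, y)" E]] xy(1) by auto
      then have "\<not> D (S x) (S y) x y \<le> r" using S(2-4) xy(2,3) unfolding E_def by blast
      moreover have "t (h (S x), h (S y)) = D (S x) (S y)" unfolding t_def using hS gh S(1) by simp
      ultimately show ?thesis by simp
    qed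
    then show "\<exists>m. \<forall>k. colourable {..<N} (\<lambda>i j. t (i, j)) r m k A"
      unfolding colourable_def using hS by (intro exI[of _ m] allI exI[of _ "\<lambda>x. h (S x)"]) auto
  qed
qed

text \<open>The booleans in a colour record membership in the two sets, so that the colours of a point
  inside and a point outside the symmetric difference tell which of the two sets to use.\<close>

definition symdiff_template ::
  "('c \<Rightarrow> 'c \<Rightarrow> 'd) \<Rightarrow> 'c \<times> bool \<times> 'c \<times> bool \<Rightarrow> 'c \<times> bool \<times> 'c \<times> bool \<Rightarrow> 'd" where
  "symdiff_template \<tau> = (\<lambda>(i, p, j, q) (i', p', j', q').
     if p \<noteq> p' then (if p then \<tau> i i' else \<tau> i' i) else (if q then \<tau> j j' else \<tau> j' j))"

text \<open>A point inside and a point outside the symmetric difference are told apart by exactly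
  one of \<open>A1\<close> and \<open>A2\<close>. The colouring of that set is used, with the points
  swapped if the second one is its member; this is where symmetry of the metrics enters.\<close>

lemma colourable_symdiff:
  assumes sym: "\<And>i j x y. i \<in> C \<Longrightarrow> j \<in> C \<Longrightarrow> \<tau> i j x y = \<tau> i j y x"
    and A1: "colourable C \<tau> r m k A1" and A2: "colourable C \<tau> r m k A2" and "m \<le> m'"
    and A: "\<And>x. x \<in> {m'..<k} \<Longrightarrow> x \<in> A \<longleftrightarrow> (x \<in> A1) \<noteq> (x \<in> A2)"
  shows "colourable (C \<times> UNIV \<times> C \<times> UNIV) (symdiff_template \<tau>) r m' k A"
proof -
  obtain c1 where c1: "\<And>x. c1 x \<in> C"
    "\<And>x y. x \<in> {m..<k} \<Longrightarrow> y \<in> {m..<k} \<Longrightarrow> x \<in> A1 \<Longrightarrow> y \<notin> A1 \<Longrightarrow> r < \<tau> (c1 x) (c1 y) x y"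
    using A1 unfolding colourable_def by blast
  obtain c2 where c2: "\<And>x. c2 x \<in> C"
    "\<And>x y. x \<in> {m..<k} \<Longrightarrow> y \<in> {m..<k} \<Longrightarrow> x \<in> A2 \<Longrightarrow> y \<notin> A2 \<Longrightarrow> r < \<tau> (c2 x) (c2 y) x y"
    using A2 unfolding colourable_def by blast
  define c where "c x = (c1 x, x \<in> A1, c2 x, x \<in> A2)" for x
  have "r < symdiff_template \<tau> (c x) (c y) x y" if xy: "x \<in> {m'..<k}" "y \<in> {m'..<k}" "x \<in> A" "y \<notin> A" for x y
  proof -
    have mk: "x \<in> {m..<k}" "y \<in> {m..<k}" using xy(1,2) \<open>m \<le> m'\<close> by auto
    consider "x \<in> A1" "y \<notin> A1" | "x \<notin> A1" "y \<in> A1" | "(x \<in> A1) = (y \<in> A1)" "x \<in> A2" "y \<notin> A2"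
      | "(x \<in> A1) = (y \<in> A1)" "x \<notin> A2" "y \<in> A2"
      using A[OF xy(1)] A[OF xy(2)] xy(3,4) by blast
    then show ?thesis
    proof cases
      case 1
      then show ?thesis using c1(2)[OF mk] by (simp add: symdiff_template_def c_def)
    next
      case 2
      then show ?thesis using c1(2)[OF mk(2,1)] sym[OF c1(1)[of y] c1(1)[of x], of x y]
        by (simp add: symdiff_template_def c_def)
    next
      case 3
      then show ?thesis using c2(2)[OF mk] by (simp add: symdiff_template_def c_def)
    next
      case 4
      then show ?thesis using c2(2)[OF mk(2,1)] sym[OF c2(1)[of y] c2(1)[of x], of x y]
        by (simp add: symdiff_template_def c_def)
    qed
  qed
  moreover have "range c \<subseteq> C \<times> UNIV \<times> C \<times> UNIV" using c1(1) c2(1) by (auto simp: c_def)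
  ultimately show ?thesis unfolding colourable_def by blast
qed

text \<open>A Steinhaus argument by counting: once the density is within a factor \<open>2\<close> of its limit,
  some stem of length \<open>n\<close> has more than half of its extensions in the tree, and a set of more than
  half of all strings meets each of its translates.\<close>

lemma dense_trees_symdiff:
  fixes S :: "nat \<Rightarrow> nat set set"
  assumes sub: "\<And>k. S k \<subseteq> Pow {..<k}"
    and restr: "\<And>k k' a. k \<le> k' \<Longrightarrow> a \<in> S k' \<Longrightarrow> a \<inter> {..<k} \<in> S k"
    and lim: "\<not> (\<lambda>k. card (S k) / 2 ^ k) \<longlonglongrightarrow> 0"
  obtains n where "\<And>k A. n \<le> k \<Longrightarrow> \<exists>a\<in>S k. \<exists>b\<in>S k. \<forall>x\<in>{n..<k}. x \<in> A \<longleftrightarrow> (x \<in> a) \<noteq> (x \<in> b)"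
proof -
  define \<delta> where "\<delta> k = card (S k) / 2 ^ k" for k
  define E where "E n k s = {u. u \<subseteq> {n..<k} \<and> s \<union> u \<in> S k}" for n k s
  have finS: "finite (S k)" for k using sub[of k] by (rule finite_subset) simp
  have finE: "finite (E n k s)" for n k s
    by (rule finite_subset[of _ "Pow {n..<k}"]) (auto simp: E_def)
  have cardS: "card (S k) \<le> (\<Sum>s\<in>S n. card (E n k s))" if "n \<le> k" for n k
  proof -
    have "S k \<subseteq> (\<Union>s\<in>S n. (\<union>) s ` E n k s)"
    proof
      fix a assume a: "a \<in> S k"
      have "a \<subseteq> {..<k}" using sub[of k] a by blast
      then have "a = (a \<inter> {..<n}) \<union> (a \<inter> {n..<k})" by auto
      moreover from this have "a \<inter> {n..<k} \<in> E n k (a \<inter> {..<n})" using a by (auto simp: E_def)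
      ultimately show "a \<in> (\<Union>s\<in>S n. (\<union>) s ` E n k s)" using restr[OF that a] by blast
    qed
    then have "card (S k) \<le> card (\<Union>s\<in>S n. (\<union>) s ` E n k s)"
      using finS finE by (intro card_mono) auto
    also have "\<dots> \<le> (\<Sum>s\<in>S n. card ((\<union>) s ` E n k s))" using finS by (rule card_UN_le)
    also have "\<dots> \<le> (\<Sum>s\<in>S n. card (E n k s))" by (intro sum_mono card_image_le finE)
    finally show ?thesis .
  qed
  have dec: "\<delta> k \<le> \<delta> n" if "n \<le> k" for n k
  proof -
    have "card (E n k s) \<le> 2 ^ (k - n)" for s
      using card_mono[of "Pow {n..<k}" "E n k s"] by (auto simp: E_def card_Pow)
    then have "card (S k) \<le> (\<Sum>s\<in>S n. 2 ^ (k - n))" using cardS[OF that] by (meson order_trans sum_mono)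
    then have "card (S k) \<le> card (S n) * 2 ^ (k - n)" by simp
    then have "real (card (S k)) \<le> real (card (S n) * 2 ^ (k - n))" by (rule of_nat_mono)
    then have "\<delta> k \<le> real (card (S n)) * 2 ^ (k - n) / 2 ^ k" unfolding \<delta>_def by (simp add: divide_right_mono)
    also have "\<dots> = \<delta> n" unfolding \<delta>_def using that by (simp add: power_diff)
    finally show ?thesis .
  qed
  have "decseq \<delta>" using dec by (simp add: decseq_def)
  moreover have nn: "0 \<le> \<delta> k" for k by (simp add: \<delta>_def)
  ultimately obtain L where L: "\<delta> \<longlonglongrightarrow> L" "\<And>k. L \<le> \<delta> k" using decseq_convergent[of \<delta> 0] by metis
  have "0 \<le> L" using L(1) nn by (intro LIMSEQ_le_const) auto
  moreover have "L \<noteq> 0" using lim L(1) unfolding \<delta>_def by auto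
  ultimately have "L < 2 * L" by simp
  then obtain n where n: "\<delta> n < 2 * L" using order_tendstoD(2)[OF L(1)] by (metis eventually_sequentially order_refl)
  show thesis
  proof (rule that[of n], rule ccontr)
    fix k A assume "n \<le> k" and no: "\<not> (\<exists>a\<in>S k. \<exists>b\<in>S k. \<forall>x\<in>{n..<k}. x \<in> A \<longleftrightarrow> (x \<in> a) \<noteq> (x \<in> b))"
    define f where "f u = {x \<in> {n..<k}. (x \<in> u) \<noteq> (x \<in> A)}" for u
    \<comment> \<open>If both \<open>u\<close> and its translate \<open>f u\<close> by
      \<open>A\<close> extended \<open>s\<close> in \<open>S k\<close>, the two extensions would
      represent \<open>A\<close> on \<open>[n, k)\<close>. So at most half of the strings extend
      \<open>s\<close>, which forces \<open>2 * \<delta> k \<le> \<delta> n\<close>.\<close>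
    have "2 * card (E n k s) \<le> 2 ^ (k - n)" if s: "s \<in> S n" for s
    proof -
      have inj: "inj_on f (Pow {n..<k})" by (rule inj_on_inverseI[of _ f]) (auto simp: f_def)
      have sE: "E n k s \<subseteq> Pow {n..<k}" by (auto simp: E_def)
      have "E n k s \<inter> f ` E n k s = {}"
      proof (rule ccontr)
        assume "\<not> ?thesis"
        then obtain u where u: "u \<in> E n k s" "f u \<in> E n k s" by blast
        then have "s \<union> u \<in> S k" "s \<union> f u \<in> S k" by (auto simp: E_def)
        moreover have "s \<inter> {n..<k} = {}" using sub[of n] s by fastforce
        then have "\<forall>x\<in>{n..<k}. x \<in> A \<longleftrightarrow> (x \<in> s \<union> u) \<noteq> (x \<in> s \<union> f u)"
          by (auto simp: f_def)
        ultimately show False using no by blast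
      qed
      then have "card (E n k s \<union> f ` E n k s) = card (E n k s) + card (f ` E n k s)"
        using finE by (simp add: card_Un_disjoint)
      also have "card (f ` E n k s) = card (E n k s)"
        using inj sE by (intro card_image) (rule inj_on_subset)
      finally have "2 * card (E n k s) = card (E n k s \<union> f ` E n k s)" by simp
      also have "\<dots> \<le> card (Pow {n..<k})" using sE by (intro card_mono) (auto simp: f_def)
      finally show ?thesis by (simp add: card_Pow)
    qed
    then have "(\<Sum>s\<in>S n. 2 * card (E n k s)) \<le> (\<Sum>s\<in>S n. 2 ^ (k - n))" by (intro sum_mono)
    then have "2 * card (S k) \<le> card (S n) * 2 ^ (k - n)"
      using cardS[OF \<open>n \<le> k\<close>] by (simp add: sum_distrib_left[symmetric])
    then have "real (2 * card (S k)) \<le> real (card (S n) * 2 ^ (k - n))" by (rule of_nat_mono)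
    then have "2 * \<delta> k \<le> real (card (S n)) * 2 ^ (k - n) / 2 ^ k"
      unfolding \<delta>_def by (simp add: divide_right_mono)
    also have "\<dots> = \<delta> n" unfolding \<delta>_def using \<open>n \<le> k\<close> by (simp add: power_diff)
    finally show False using n L(2)[of k] by simp
  qed
qed

section \<open>Merging colourings of all scales\<close>

lemma block_sequence:
  fixes F :: "(nat \<Rightarrow> nat \<Rightarrow> real) set" and m :: "nat \<Rightarrow> nat"
  assumes F: "finite F" "F \<subseteq> PM"
  obtains n where "strict_mono n" "\<And>j. m j \<le> n j"
    "\<And>j d x y. d \<in> F \<Longrightarrow> x < n j \<Longrightarrow> d x y \<le> real j \<Longrightarrow> y < n (Suc j)"
proof -
  \<comment> \<open>Balls and \<open>F\<close> are finite, so only finitely many points come within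
    \<open>j\<close> of a point below \<open>N\<close>; the sequence then arises by
    recursion.\<close>
  have "\<exists>N'. N < N' \<and> m (Suc j) \<le> N' \<and> (\<forall>d\<in>F. \<forall>x<N. \<forall>y. d x y \<le> real j \<longrightarrow> y < N')" for N j
  proof -
    have "finite (\<Union>d\<in>F. \<Union>x<N. {y. d x y \<le> real j})"
      using F PM_finite_cball by blast
    then obtain M where M: "\<forall>y\<in>(\<Union>d\<in>F. \<Union>x<N. {y. d x y \<le> real j}). y < M"
      unfolding finite_nat_set_iff_bounded ..
    have "y < M" if "d \<in> F" "x < N" "d x y \<le> real j" for d x y using M that by blast
    then show ?thesis by (intro exI[of _ "Suc (max N (max M (m (Suc j))))"]) (fastforce simp: less_max_iff_disj less_Suc_eq)
  qed
  then have "\<exists>n. \<forall>j. (m j \<le> n j) \<and> (n j < n (Suc j) \<and>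
      (\<forall>d\<in>F. \<forall>x<n j. \<forall>y. d x y \<le> real j \<longrightarrow> y < n (Suc j)))"
    by (intro dependent_nat_choice) blast+
  then obtain n where "\<And>j. m j \<le> n j" "\<And>j. n j < n (Suc j)"
    "\<And>j d x y. d \<in> F \<Longrightarrow> x < n j \<Longrightarrow> d x y \<le> real j \<Longrightarrow> y < n (Suc j)" by blast
  then show thesis by (intro that[of n]) (auto simp: strict_mono_Suc_iff)
qed

text \<open>The number of scales is infinite, so their colourings have to be merged into one. Cut
  \<open>\<omega>\<close> into blocks such that points at bounded distance lie in the same or in neighbouring blocks,
  and let a point of block \<open>b\<close> carry its colours at the scales \<open>b\<close> and \<open>b - 1\<close>
  together with \<open>b mod 3\<close>: two neighbouring points then share a scale, and the residues tell
  which one.\<close>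

lemma separated_by_if_colourable:
  fixes C :: "'c set"
  assumes F: "finite F" "F \<subseteq> PM" and C: "finite C" and \<tau>: "\<And>i j. i \<in> C \<Longrightarrow> j \<in> C \<Longrightarrow> \<tau> i j \<in> F"
    and col: "\<And>j::nat. \<exists>m. \<forall>k. colourable C \<tau> (real j) m k A"
  shows "separated_by F A"
proof -
  obtain m where m: "\<And>j k. colourable C \<tau> (real j) (m j) k A" using col by metis
  obtain n where n: "strict_mono n" "\<And>j. m j \<le> n j"
    "\<And>j d x y. d \<in> F \<Longrightarrow> x < n j \<Longrightarrow> d x y \<le> real j \<Longrightarrow> y < n (Suc j)"
    using block_sequence[OF F, of m] by metis
  \<comment> \<open>Scale \<open>j\<close> serves blocks \<open>j\<close> and \<open>j + 1\<close>,
    which end at \<open>n (j + 2)\<close>.\<close>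
  have "\<exists>c. (\<forall>x. c x \<in> C) \<and> (\<forall>x y. m j \<le> x \<longrightarrow> x < n (j + 2) \<longrightarrow> m j \<le> y \<longrightarrow> y < n (j + 2) \<longrightarrow>
      x \<in> A \<longrightarrow> y \<notin> A \<longrightarrow> real j < \<tau> (c x) (c y) x y)" for j
    using m[of j "n (j + 2)"] unfolding colourable_def by fastforce
  then obtain c where c: "\<And>j x. c j x \<in> C"
    "\<And>j x y. \<lbrakk>m j \<le> x; x < n (j + 2); m j \<le> y; y < n (j + 2); x \<in> A; y \<notin> A\<rbrakk> \<Longrightarrow>
       real j < \<tau> (c j x) (c j y) x y" by metis
  \<comment> \<open>The number of the block of \<open>x\<close>: block 0 is \<open>[0, n 1)\<close>,
    and block \<open>j > 0\<close> is \<open>[n j, n (j + 1))\<close>.\<close>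
  define b where "b x = (LEAST j. x < n (Suc j))" for x
  have b1: "x < n (Suc (b x))" for x
    unfolding b_def
  proof (rule LeastI_ex)
    have "x < n (Suc x)" using seq_suble[OF n(1), of "Suc x"] by simp
    then show "\<exists>j. x < n (Suc j)" ..
  qed
  have b2: "n (b x) \<le> x" if "0 < b x" for x
  proof -
    have "\<not> x < n (Suc (b x - 1))" using not_less_Least[of "b x - 1" "\<lambda>j. x < n (Suc j)"] that by (simp add: b_def)
    then show ?thesis using that by simp
  qed
  have near: "b y \<le> Suc (b x)" if "d \<in> F" "d x y \<le> real (Suc (b x))" for d x y
  proof -
    have "y < n (Suc (Suc (b x)))" using n(3)[OF that(1) b1 that(2)] .
    then show ?thesis unfolding b_def[of y] by (rule Least_le)
  qed
  have sym: "d x y = d y x" if "d \<in> F" for d x y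
    by (rule Metric_space.commute[OF PM_metric]) (use that F(2) in auto)
  define col where "col x = (b x mod 3, c (b x) x, c (b x - 1) x)" for x
  \<comment> \<open>Points in the same or neighbouring blocks share the scale given by the lower
    block number. The three cases are: same block, second point one block later, second point one
    block earlier.\<close>
  define \<sigma> where "\<sigma> = (\<lambda>(s :: nat, i, i') (s', j, j').
     if s' = s then \<tau> i j else if s' = Suc s mod 3 then \<tau> i j' else \<tau> i' j)"
  have \<sigma>F: "\<sigma> (col x) (col y) \<in> F" for x y
    using c(1) by (auto simp: \<sigma>_def col_def intro!: \<tau>)
  have fin: "finite (range col)"
    by (rule finite_subset[of _ "{..<3} \<times> C \<times> C"]) (use C c(1) in \<open>auto simp: col_def\<close>)
  have asym: "asym_disjoint (\<sigma> (col x0) (col y0)) {x \<in> A. col x = col x0} {y \<in> - A. col y = col y0}" for x0 y0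
    unfolding asym_disjoint_def
  proof
    fix r :: real
    define R where "R = nat \<lceil>r\<rceil>"
    have R: "r \<le> real R" by (simp add: R_def real_nat_ceiling_ge)
    let ?d = "\<sigma> (col x0) (col y0)"
    \<comment> \<open>If one point were beyond \<open>n (R + 2)\<close>, the other would be beyond
      \<open>n (R + 1)\<close>. Both block numbers then exceed \<open>R\<close>, so the shared scale
      exceeds \<open>r\<close>, contrary to the distance.\<close>
    have "x < n (R + 2) \<and> y < n (R + 2)"
      if xy: "x \<in> A" "y \<notin> A" "col x = col x0" "col y = col y0" "?d x y \<le> r" for x y
    proof (rule ccontr)
      assume far: "\<not> ?thesis"
      have "\<not> x < n (Suc R)"
        using n(3)[OF \<sigma>F, of x "Suc R" x0 y0 y] R xy(5) far strict_mono_less[OF n(1), of "Suc R" "R + 2"] by auto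
      then have "R < b x" using b1[of x] strict_mono_less_eq[OF n(1), of "Suc (b x)" "Suc R"] by force
      have "\<not> y < n (Suc R)"
        using n(3)[OF \<sigma>F, of y "Suc R" x0 y0 x] sym[OF \<sigma>F, of x0 y0 x y] R xy(5) far
          strict_mono_less[OF n(1), of "Suc R" "R + 2"] by auto
      then have "R < b y" using b1[of y] strict_mono_less_eq[OF n(1), of "Suc (b y)" "Suc R"] by force
      have "b y \<le> Suc (b x)" by (rule near[OF \<sigma>F[of x0 y0]]) (use xy(5) R \<open>R < b x\<close> in linarith)
      moreover have "b x \<le> Suc (b y)"
        by (rule near[OF \<sigma>F[of x0 y0]]) (use xy(5) R \<open>R < b y\<close> sym[OF \<sigma>F, of x0 y0 x y] in linarith)
      ultimately consider "b y = b x" | "b y = Suc (b x)" | "b x = Suc (b y)" by linarith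
      then obtain j where j: "R < j" "j \<le> b x" "j \<le> b y" "b x \<le> Suc j" "b y \<le> Suc j"
        and d: "\<sigma> (col x) (col y) = \<tau> (c j x) (c j y)"
      proof cases
        case 1
        then show thesis using that[of "b x"] \<open>R < b x\<close> by (simp add: \<sigma>_def col_def)
      next
        case 2
        have "Suc (b x) mod 3 \<noteq> b x mod 3" by presburger
        with 2 show thesis using that[of "b x"] \<open>R < b x\<close> by (simp add: \<sigma>_def col_def mod_Suc_eq)
      next
        case 3
        have "Suc (b y) mod 3 \<noteq> b y mod 3" "Suc (Suc (b y)) mod 3 \<noteq> b y mod 3" by presburger+
        with 3 show thesis using that[of "b y"] \<open>R < b y\<close> by (simp add: \<sigma>_def col_def mod_Suc_eq)
      qed
      have "m j \<le> z \<and> z < n (j + 2)" if "j \<le> b z" "b z \<le> Suc j" for z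
      proof
        have "n j \<le> n (b z)" using strict_mono_less_eq[OF n(1)] that(1) by blast
        then show "m j \<le> z" using n(2)[of j] b2[of z] that(1) j(1) by linarith
        have "n (Suc (b z)) \<le> n (j + 2)" using strict_mono_less_eq[OF n(1)] that(2) by simp
        then show "z < n (j + 2)" using b1[of z] by linarith
      qed
      then have "real j < \<tau> (c j x) (c j y) x y" using j xy(1,2) by (intro c(2)) auto
      then show False using d xy(3-5) R j(1) by simp
    qed
    then have "{(x, y). x \<in> {x \<in> A. col x = col x0} \<and> y \<in> {y \<in> - A. col y = col y0} \<and> ?d x y \<le> r}
        \<subseteq> {..<n (R + 2)} \<times> {..<n (R + 2)}" by blast
    then show "finite {(x, y). x \<in> {x \<in> A. col x = col x0} \<and> y \<in> {y \<in> - A. col y = col y0} \<and> ?d x y \<le> r}"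
      by (rule finite_subset) simp
  qed
  show ?thesis
    unfolding separated_by_def
  proof (rule exI[of _ "(\<lambda>u. {x \<in> A. col x = u}) ` range col"],
      rule exI[of _ "(\<lambda>u. {x \<in> - A. col x = u}) ` range col"], intro conjI ballI)
    fix P Q assume "P \<in> (\<lambda>u. {x \<in> A. col x = u}) ` range col" "Q \<in> (\<lambda>u. {x \<in> - A. col x = u}) ` range col"
    then obtain x0 y0 where "P = {x \<in> A. col x = col x0}" "Q = {y \<in> - A. col y = col y0}" by blast
    then show "\<exists>d\<in>F. asym_disjoint d P Q" using asym \<sigma>F by blast
  qed (use fin in auto)
qed

section \<open>Trees of colourable initial segments\<close>

definition colour_tree ::
  "'c set \<Rightarrow> ('c \<Rightarrow> 'c \<Rightarrow> nat \<Rightarrow> nat \<Rightarrow> real) \<Rightarrow> real \<Rightarrow> nat \<Rightarrow> nat \<Rightarrow> nat set set" where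
  "colour_tree C \<tau> r m k = {a. a \<subseteq> {..<k} \<and> colourable C \<tau> r m k a}"

text \<open>Beyond some integer, density at a scale writes every set as a symmetric difference of
  two nodes, hence colours it. The product template does not depend on the scale, so the scales can
  be merged.\<close>

lemma separated_by_if_dense_colour_trees:
  fixes C :: "'c set"
  assumes F: "finite F" "F \<subseteq> PM" and C: "finite C" and \<tau>: "\<And>i j. i \<in> C \<Longrightarrow> j \<in> C \<Longrightarrow> \<tau> i j \<in> F"
    and dense: "\<And>j::nat. \<exists>m. \<not> (\<lambda>k. card (colour_tree C \<tau> (real j) m k) / 2 ^ k) \<longlonglongrightarrow> 0"
  shows "separated_by F A"
proof -
  let ?C = "C \<times> (UNIV :: bool set) \<times> C \<times> (UNIV :: bool set)"
  have template: "symdiff_template \<tau> u v \<in> F" if "u \<in> ?C" "v \<in> ?C" for u v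
    using that by (auto simp: symdiff_template_def intro!: \<tau>)
  have sym: "\<tau> i j x y = \<tau> i j y x" if "i \<in> C" "j \<in> C" for i j x y
    by (rule Metric_space.commute[OF PM_metric]) (use \<tau>[OF that] F(2) in auto)
  have "\<exists>m. \<forall>k. colourable ?C (symdiff_template \<tau>) (real j) m k A" for j :: nat
  proof -
    obtain m where m: "\<not> (\<lambda>k. card (colour_tree C \<tau> (real j) m k) / 2 ^ k) \<longlonglongrightarrow> 0"
      using dense by blast
    have sub: "colour_tree C \<tau> (real j) m k \<subseteq> Pow {..<k}" for k by (auto simp: colour_tree_def)
    have restr: "a \<inter> {..<k} \<in> colour_tree C \<tau> (real j) m k"
      if "k \<le> k'" "a \<in> colour_tree C \<tau> (real j) m k'" for k k' a
      using that colourable_mono[of C \<tau> "real j" m k' a m k "a \<inter> {..<k}"] by (auto simp: colour_tree_def)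
    have "\<exists>n. \<forall>k A. n \<le> k \<longrightarrow> (\<exists>a\<in>colour_tree C \<tau> (real j) m k. \<exists>b\<in>colour_tree C \<tau> (real j) m k.
        \<forall>x\<in>{n..<k}. x \<in> A \<longleftrightarrow> (x \<in> a) \<noteq> (x \<in> b))"
      by (rule dense_trees_symdiff[OF sub _ m]) (erule (1) restr, blast)
    then obtain n where n: "\<And>k A. n \<le> k \<Longrightarrow> \<exists>a\<in>colour_tree C \<tau> (real j) m k.
        \<exists>b\<in>colour_tree C \<tau> (real j) m k. \<forall>x\<in>{n..<k}. x \<in> A \<longleftrightarrow> (x \<in> a) \<noteq> (x \<in> b)"
      by blast
    have "colourable ?C (symdiff_template \<tau>) (real j) (max m n) k A" for k
    proof -
      \<comment> \<open>The representation is available at levels from \<open>n\<close> on; for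
        smaller \<open>k\<close> the colouring is restricted from level \<open>n\<close>.\<close>
      obtain a b where ab: "colourable C \<tau> (real j) m (max n k) a" "colourable C \<tau> (real j) m (max n k) b"
         "\<And>x. x \<in> {n..<max n k} \<Longrightarrow> x \<in> A \<longleftrightarrow> (x \<in> a) \<noteq> (x \<in> b)"
        using n[of "max n k" A] by (auto simp: colour_tree_def)
      have "colourable ?C (symdiff_template \<tau>) (real j) (max m n) (max n k) A"
        by (rule colourable_symdiff[OF sym ab(1,2)]) (use ab(3) in auto)
      then show ?thesis by (rule colourable_mono) auto
    qed
    then show ?thesis by blast
  qed
  then show ?thesis
    using C by (intro separated_by_if_colourable[OF F, of ?C "symdiff_template \<tau>"] template) auto
qed

section \<open>Null and nowhere dense sets of branches\<close>

definition branches :: "(nat \<Rightarrow> nat set set) \<Rightarrow> (nat \<Rightarrow> bool) set" where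
  "branches S = {X. \<forall>k. {i. i < k \<and> X i} \<in> S k}"

text \<open>An upper bound instead of equality, since the cylinder is empty if \<open>s\<close> is
  not contained in \<open>{..<k}\<close>.\<close>

lemma cylinder_emeasure:
  "{X. {i. i < k \<and> X i} = s} \<in> sets cantor_measure \<and>
   emeasure cantor_measure {X. {i. i < k \<and> X i} = s} \<le> ennreal (1 / 2 ^ k)"
proof (cases "s \<subseteq> {..<k}")
  case False
  then have "{X. {i. i < k \<and> X i} = s} = {}" by blast
  then show ?thesis by simp
next
  case True
  let ?M = "\<lambda>_::nat. uniform_count_measure (UNIV :: bool set)"
  have p: "prob_space (uniform_count_measure (UNIV :: bool set))"
    by (rule prob_space_uniform_count_measure) auto
  then interpret product_prob_space ?M UNIV
    by (intro product_prob_spaceI) auto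
  let ?E = "prod_emb UNIV ?M {..<k} (PiE {..<k} (\<lambda>i. {i \<in> s}))"
  have E: "{X. {i. i < k \<and> X i} = s} = ?E"
    using True by (auto simp: prod_emb_def PiE_iff space_uniform_count_measure)
  have "?E \<in> sets (Pi\<^sub>M UNIV ?M)"
    by (rule sets_PiM_I) (auto simp: sets_uniform_count_measure)
  moreover have "emeasure (Pi\<^sub>M UNIV ?M) ?E = (\<Prod>i\<in>{..<k}. emeasure (uniform_count_measure UNIV) {i \<in> s})"
    by (rule emeasure_PiM_emb) (auto simp: sets_uniform_count_measure)
  moreover have "\<dots> = ennreal (1 / 2 ^ k)"
  proof -
    have "emeasure (uniform_count_measure UNIV) {b} = ennreal (1 / 2)" for b :: bool
      by (simp add: emeasure_uniform_count_measure)
    then have "(\<Prod>i\<in>{..<k}. emeasure (uniform_count_measure UNIV) {i \<in> s}) = ennreal (1 / 2) ^ k"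
      by (simp only: prod_constant card_lessThan)
    also have "\<dots> = ennreal ((1 / 2) ^ k)" by (rule ennreal_power) simp
    finally show ?thesis by (simp only: power_one_over)
  qed
  ultimately show ?thesis unfolding E cantor_measure_def by simp
qed

lemma branches_null:
  assumes fin: "\<And>k. finite (S k)" and lim: "(\<lambda>k. card (S k) / 2 ^ k) \<longlonglongrightarrow> 0"
  shows "branches S \<in> null_sets cantor_measure"
proof -
  define Cy where "Cy k = (\<Union>s\<in>S k. {X. {i. i < k \<and> X i} = s})" for k
  have Cs: "Cy k \<in> sets cantor_measure" for k
    unfolding Cy_def using fin cylinder_emeasure by (intro sets.finite_UN) auto
  have Ce: "emeasure cantor_measure (Cy k) \<le> ennreal (card (S k) / 2 ^ k)" for k
  proof -
    have "emeasure cantor_measure (Cy k) \<le> (\<Sum>s\<in>S k. emeasure cantor_measure {X. {i. i < k \<and> X i} = s})"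
      unfolding Cy_def using fin cylinder_emeasure by (intro emeasure_subadditive_finite) auto
    also have "\<dots> \<le> (\<Sum>s\<in>S k. ennreal (1 / 2 ^ k))"
      using cylinder_emeasure by (intro sum_mono) auto
    also have "\<dots> = ennreal (card (S k) / 2 ^ k)"
      by (simp add: ennreal_of_nat_eq_real_of_nat ennreal_mult[symmetric])
    finally show ?thesis .
  qed
  have eq: "branches S = (\<Inter>k. Cy k)" by (auto simp: branches_def Cy_def)
  have s: "branches S \<in> sets cantor_measure" unfolding eq using Cs by auto
  have "emeasure cantor_measure (branches S) \<le> ennreal (card (S k) / 2 ^ k)" for k
  proof -
    have "emeasure cantor_measure (branches S) \<le> emeasure cantor_measure (Cy k)"
      by (rule emeasure_mono) (use Cs eq in auto)
    then show ?thesis using Ce[of k] by (rule order_trans)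
  qed
  moreover have "(\<lambda>k. ennreal (card (S k) / 2 ^ k)) \<longlonglongrightarrow> ennreal 0"
    using lim by (rule tendsto_ennrealI)
  ultimately have "emeasure cantor_measure (branches S) \<le> ennreal 0"
    by (intro LIMSEQ_le_const) auto
  then show ?thesis using s by (auto simp: null_sets_def)
qed

lemma topspace_cantor: "topspace cantor_topology = UNIV"
  by (simp add: cantor_topology_def)

lemma openin_cantor_cylinder: "openin cantor_topology {X. \<forall>i<k. X i = x i}"
proof -
  have "{X. \<forall>i<k. X i = x i} = PiE UNIV (\<lambda>i. if i < k then {x i} else UNIV)"
    by (auto simp: PiE_iff split: if_splits)
  moreover have "openin cantor_topology (PiE UNIV (\<lambda>i. if i < k then {x i} else UNIV))"
    unfolding cantor_topology_def openin_PiE_gen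
    by (auto intro!: disjI2 finite_subset[of _ "{..<k}"])
  ultimately show ?thesis by simp
qed

text \<open>If the closure contained a basic open set determined by \<open>n\<close> coordinates,
  level \<open>k \<ge> n\<close> would contain all \<open>2 ^ (k - n)\<close> extensions of a stem,
  and the densities would stay at least \<open>1 / 2 ^ n\<close>.\<close>

lemma branches_nowhere_dense:
  assumes fin: "\<And>k. finite (S k)" and lim: "(\<lambda>k. card (S k) / 2 ^ k) \<longlonglongrightarrow> 0"
  shows "nowhere_dense_in cantor_topology (branches S)"
proof -
  have "cantor_topology interior_of (cantor_topology closure_of branches S) = {}"
  proof (rule ccontr)
    assume "\<not> ?thesis"
    then obtain T x where T: "openin cantor_topology T" "x \<in> T" "T \<subseteq> cantor_topology closure_of branches S"
      by (auto simp: interior_of_def)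
    obtain U where U: "finite {i. U i \<noteq> UNIV}" "x \<in> PiE UNIV U" "PiE UNIV U \<subseteq> T"
      using T(1,2) unfolding cantor_topology_def openin_product_topology_alt by auto
    obtain n where n: "\<And>i. U i \<noteq> UNIV \<Longrightarrow> i < n"
      using U(1) unfolding finite_nat_set_iff_bounded by blast
    define s where "s = {i. i < n \<and> x i}"
    have ext: "s \<union> u \<in> S k" if u: "u \<subseteq> {n..<k}" "n \<le> k" for u k
    proof -
      let ?Y = "\<lambda>i. i \<in> s \<union> u"
      have "?Y \<in> PiE UNIV U"
      proof -
        have "?Y i \<in> U i" for i
        proof (cases "i < n")
          case True
          then have "?Y i = x i" using u(1) by (auto simp: s_def)
          then show ?thesis using U(2) by (simp only:) (auto simp: PiE_iff)
        next
          case False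
          then show ?thesis using n[of i] by blast
        qed
        then show ?thesis by auto
      qed
      then have cl: "?Y \<in> cantor_topology closure_of branches S" using U(3) T(3) by blast
      \<comment> \<open>A point of the closure agrees with some branch on its first \<open>k\<close>
        coordinates, so its restriction is a node.\<close>
      have "\<exists>Z. Z \<in> branches S \<and> Z \<in> {X. \<forall>i<k. X i = ?Y i}"
        by (rule cl[unfolded in_closure_of, THEN conjunct2, rule_format])
           (use openin_cantor_cylinder[of k ?Y] in simp)
      then obtain Z where Z: "Z \<in> branches S" "\<forall>i<k. Z i = ?Y i" by blast
      have "{i. i < k \<and> Z i} = s \<union> u" using Z(2) u by (auto simp: s_def)
      moreover have "{i. i < k \<and> Z i} \<in> S k" using Z(1) by (simp add: branches_def)
      ultimately show ?thesis by simp
    qed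
    have "1 / 2 ^ n \<le> card (S k) / 2 ^ k" if "n \<le> k" for k
    proof -
      have "inj_on (\<lambda>u. s \<union> u) (Pow {n..<k})"
      proof (rule inj_on_inverseI[of _ "\<lambda>v. v \<inter> {n..<k}"])
        show "(s \<union> u) \<inter> {n..<k} = u" if "u \<in> Pow {n..<k}" for u
          using that by (auto simp: s_def)
      qed
      then have "card (Pow {n..<k}) \<le> card (S k)"
        by (rule card_inj_on_le) (use ext that fin in auto)
      then have "2 ^ (k - n) \<le> card (S k)" by (simp add: card_Pow)
      then have "real (2 ^ (k - n)) \<le> real (card (S k))" by (rule of_nat_mono)
      then have "2 ^ (k - n) / 2 ^ k \<le> card (S k) / 2 ^ k" by (simp add: divide_right_mono)
      then show ?thesis using that by (simp add: power_diff)
    qed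
    then have "1 / 2 ^ n \<le> (0::real)"
      using LIMSEQ_le_const[OF lim] by blast
    moreover have "0 < 1 / (2 :: real) ^ n" by simp
    ultimately show False by linarith
  qed
  then show ?thesis by (simp add: nowhere_dense_in_def topspace_cantor)
qed

text \<open>There are countably many templates \<open>(N, t)\<close>. Each has a scale at which the
  trees are thin for every \<open>m\<close>, and the union of their branches over all templates and
  all \<open>m\<close> covers the separated sets.\<close>

lemma separated_sets_small:
  assumes F: "finite F" "F \<noteq> {}" "F \<subseteq> PM" and A0: "\<not> separated_by F A0"
  obtains B where "B \<in> meager_ideal" "B \<in> null_ideal" "\<And>X. separated_by F {i. X i} \<Longrightarrow> X \<in> B"
proof -
  define T where "T = (SIGMA N:(UNIV :: nat set). {..<N} \<times> {..<N} \<rightarrow>\<^sub>E F)"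
  define S where "S p r m = colour_tree {..<fst p} (\<lambda>i j. snd p (i, j)) r m"
    for p :: "nat \<times> (nat \<times> nat \<Rightarrow> nat \<Rightarrow> nat \<Rightarrow> real)" and r m
  have "countable T" unfolding T_def
    using F(1) by (intro countable_SIGMA) (auto intro!: countable_finite finite_PiE)
  have fin: "finite (S p r m k)" for p r m k
    by (rule finite_subset[of _ "Pow {..<k}"]) (auto simp: S_def colour_tree_def)
  \<comment> \<open>The scale has to work for all \<open>m\<close>, since \<open>m\<close> depends
    on the set to be covered. Without such a scale \<open>F\<close> would separate every set,
    including \<open>A0\<close>.\<close>
  have "\<exists>j::nat. \<forall>m. (\<lambda>k. card (S p (real j) m k) / 2 ^ k) \<longlonglongrightarrow> 0" if p: "p \<in> T" for p
  proof (rule ccontr)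
    assume no: "\<not> ?thesis"
    have "separated_by F A0"
    proof (rule separated_by_if_dense_colour_trees[OF F(1,3), of "{..<fst p}" "\<lambda>i j. snd p (i, j)"])
      show "snd p (i, j) \<in> F" if "i \<in> {..<fst p}" "j \<in> {..<fst p}" for i j
        using p that by (auto simp: T_def)
      show "\<exists>m. \<not> (\<lambda>k. card (colour_tree {..<fst p} (\<lambda>i j. snd p (i, j)) (real j) m k) / 2 ^ k) \<longlonglongrightarrow> 0" for j :: nat
        using no unfolding S_def by blast
    qed simp
    with A0 show False by blast
  qed
  then obtain r where r: "\<And>p m. p \<in> T \<Longrightarrow> (\<lambda>k. card (S p (real (r p)) m k) / 2 ^ k) \<longlonglongrightarrow> 0" by metis
  define \<B> where "\<B> = (\<lambda>(p, m). branches (S p (real (r p)) m)) ` (T \<times> UNIV)"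
  have cB: "countable \<B>" unfolding \<B>_def using \<open>countable T\<close> by auto
  have nB: "nowhere_dense_in cantor_topology B" "B \<in> null_sets cantor_measure" if "B \<in> \<B>" for B
    using that branches_nowhere_dense[OF fin r] branches_null[OF fin r] by (auto simp: \<B>_def)
  show thesis
  proof (rule that[of "\<Union>\<B>"])
    show "\<Union>\<B> \<in> meager_ideal" using cB nB(1) unfolding meager_ideal_def by blast
    have "(\<Union>B\<in>\<B>. B) \<in> null_sets cantor_measure" using cB nB(2) by (rule null_sets_UN')
    then show "\<Union>\<B> \<in> null_ideal" unfolding null_ideal_def by (auto intro: null_sets_completionI)
    fix X assume "separated_by F {i. X i}"
    then obtain N :: nat and t where t: "t \<in> {..<N} \<times> {..<N} \<rightarrow>\<^sub>E F"
        "\<And>r. \<exists>m. \<forall>k. colourable {..<N} (\<lambda>i j. t (i, j)) r m k {i. X i}"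
      using separated_by_imp_colourable[OF _ F(2)] by metis
    then have p: "(N, t) \<in> T" by (simp add: T_def)
    obtain m where m: "\<And>k. colourable {..<N} (\<lambda>i j. t (i, j)) (real (r (N, t))) m k {i. X i}" using t(2) by blast
    have "{i. i < k \<and> X i} \<in> S (N, t) (real (r (N, t))) m k" for k
      unfolding S_def colour_tree_def using colourable_mono[OF m[of k], of m k "{i. i < k \<and> X i}"] by auto
    then have "X \<in> branches (S (N, t) (real (r (N, t))) m)" by (simp add: branches_def)
    then show "X \<in> \<Union>\<B>" unfolding \<B>_def using p by blast
  qed
qed

section \<open>Cardinalities\<close>

lemma least_card_cases:
  obtains A where "P A" "least_card P = Card |A|" "\<And>B. P B \<Longrightarrow> |A| \<le>o |B|"
  | "\<And>A. \<not> P A" "least_card P = Infty"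
proof (cases "\<exists>A. P A")
  case True
  then have "\<exists>r\<in>card_of ` Collect P. \<forall>r'\<in>card_of ` Collect P. r \<le>o r'"
    by (intro exists_minim_Card_order) (auto simp: card_of_Card_order)
  then have "\<exists>r A. P A \<and> r = |A| \<and> (\<forall>B. P B \<longrightarrow> |A| \<le>o |B| )" by blast
  from someI_ex[OF this] obtain A where "P A" "(SOME r. \<exists>A. P A \<and> r = |A| \<and> (\<forall>B. P B \<longrightarrow> |A| \<le>o |B| )) = |A|"
      "\<forall>B. P B \<longrightarrow> |A| \<le>o |B|" by blast
  then show thesis using that(1) True by (simp add: least_card_def)
next
  case False
  then show thesis using that(2) by (simp add: least_card_def)
qed

lemma least_card_le:
  assumes "\<And>D. Q D \<Longrightarrow> \<exists>Y. P Y \<and> |Y| \<le>o |D|"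
  shows "ecard_le (least_card P) (least_card Q)"
proof (rule least_card_cases[of Q])
  fix D assume D: "Q D" "least_card Q = Card |D|"
  obtain Y where Y: "P Y" "|Y| \<le>o |D|" using assms[OF D(1)] by blast
  show ?thesis
  proof (rule least_card_cases[of P])
    fix A assume "least_card P = Card |A|" "\<And>B. P B \<Longrightarrow> |A| \<le>o |B|"
    then show ?thesis using Y D(2) ordLeq_transitive by auto
  qed (use Y(1) in blast)
qed simp

text \<open>Finite subsets are ranges of lists. For each length there are at most \<open>|D|\<close>
  lists, and there are countably many lengths.\<close>

lemma card_of_finite_subsets:
  assumes "infinite D"
  shows "|{F. finite F \<and> F \<subseteq> D}| \<le>o |D|"
proof -
  define L where "L n = {xs. set xs \<subseteq> D \<and> length xs = n}" for n
  have L: "|L n| \<le>o |D|" for n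
  proof (induction n)
    case 0
    have "L 0 = {[]}" by (auto simp: L_def)
    then show ?case using assms by (metis card_of_ordLeq_infinite card_of_Well_order finite.emptyI finite.insertI ordLeq_total)
  next
    case (Suc n)
    have "L (Suc n) = (\<lambda>(x, xs). x # xs) ` (D \<times> L n)"
      by (auto simp: L_def length_Suc_conv image_iff)
    then have "|L (Suc n)| \<le>o |D \<times> L n|" by (simp add: card_of_image)
    also have "|D \<times> L n| \<le>o |D|"
      using card_of_Times_mono2[OF Suc] card_of_Times_same_infinite[OF assms] ordLeq_ordIso_trans by blast
    finally show ?case .
  qed
  have "{F. finite F \<and> F \<subseteq> D} = set ` (\<Union>n. L n)"
    by (auto simp: L_def image_iff) (metis finite_list)
  then have "|{F. finite F \<and> F \<subseteq> D}| \<le>o |\<Union>n. L n|" by (simp add: card_of_image)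
  also have "|\<Union>n. L n| \<le>o |D|"
    using assms L by (intro card_of_UNION_ordLeq_infinite) (auto simp: infinite_iff_card_of_nat)
  finally show ?thesis .
qed

text \<open>For each nonempty finite \<open>F \<subseteq> D\<close> the FIP yields a set not
  separated by \<open>F\<close>, so the sets separated by \<open>F\<close> lie in one small set.
  Every set is separated by some such \<open>F\<close>.\<close>

lemma small_cover:
  assumes D: "D \<subseteq> PM'" "higson_FIP D" "cptf_eq beta_omega (cptf_sup (higson ` D))"
  obtains \<Y> where "\<Y> \<subseteq> meager_ideal" "\<Y> \<subseteq> null_ideal" "\<Union>\<Y> = UNIV" "|\<Y>| \<le>o |D|"
proof -
  have PM: "D \<subseteq> PM" using D(1) by (auto simp: PM'_def)
  \<comment> \<open>A finite \<open>D\<close> could itself be taken as \<open>F\<close> in the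
    FIP.\<close>
  have inf: "infinite D" using D(2,3) unfolding higson_FIP_def by blast
  then have ne: "D \<noteq> {}" by auto
  define \<F> where "\<F> = {F. finite F \<and> F \<subseteq> D} - {{}}"
  have "\<exists>B. B \<in> meager_ideal \<and> B \<in> null_ideal \<and> (\<forall>X. separated_by F {i. X i} \<longrightarrow> X \<in> B)" if "F \<in> \<F>" for F
  proof -
    have F: "finite F" "F \<noteq> {}" "F \<subseteq> PM" "F \<subseteq> D" using that PM by (auto simp: \<F>_def)
    then have "\<not> cptf_eq beta_omega (cptf_sup (higson ` F))" using D(2) by (simp add: higson_FIP_def)
    then obtain A0 where "\<not> separated_by F A0" using beta_if_separated_by[OF F(3,2)] by blast
    then show ?thesis using separated_sets_small[OF F(1-3)] by metis
  qed
  then obtain B where B: "\<And>F. F \<in> \<F> \<Longrightarrow> B F \<in> meager_ideal" "\<And>F. F \<in> \<F> \<Longrightarrow> B F \<in> null_ideal"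
    "\<And>F X. F \<in> \<F> \<Longrightarrow> separated_by F {i. X i} \<Longrightarrow> X \<in> B F" by metis
  show thesis
  proof (rule that[of "B ` \<F>"])
    show "B ` \<F> \<subseteq> meager_ideal" "B ` \<F> \<subseteq> null_ideal" using B by auto
    have "X \<in> \<Union>(B ` \<F>)" for X
    proof -
      obtain F where F: "finite F" "F \<subseteq> D" "separated_by F {i. X i}"
        using separated_by_if_beta[OF PM ne D(3)] by metis
      obtain d where "d \<in> D" using ne by blast
      \<comment> \<open>Adding \<open>d\<close> makes the family nonempty without losing
        separation.\<close>
      have "insert d F \<in> \<F>" using F \<open>d \<in> D\<close> by (simp add: \<F>_def)
      moreover have "separated_by (insert d F) {i. X i}" using F(3) by (rule separated_by_mono) auto
      ultimately show ?thesis using B(3) by blast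
    qed
    then show "\<Union>(B ` \<F>) = UNIV" by blast
    have "|B ` \<F>| \<le>o |\<F>|" by (rule card_of_image)
    also have "|\<F>| \<le>o |{F. finite F \<and> F \<subseteq> D}|" by (rule card_of_mono1) (auto simp: \<F>_def)
    also have "|{F. finite F \<and> F \<subseteq> D}| \<le>o |D|" using inf by (rule card_of_finite_subsets)
    finally show "|B ` \<F>| \<le>o |D|" .
  qed
qed

theorem corollary6p10:
  shows "ecard_le (cov meager_ideal) hp \<and> ecard_le (cov null_ideal) hp"
proof
  show "ecard_le (cov meager_ideal) hp"
    unfolding cov_def hp_def by (rule least_card_le) (use small_cover in metis)
  show "ecard_le (cov null_ideal) hp"
    unfolding cov_def hp_def by (rule least_card_le) (use small_cover in metis)
qed

end
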